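(* Let $a,b\ge0$ and let $\nu$ be a measure on $\mathbb R^+$ with $\int_{\mathbb R^+}(x\wedge x^2)\,\nu(dx)<\infty$. Let $L=(L_t)_{t\ge0}$ be a spectrally positive Lévy process with characteristic exponent \[\Psi_L(\lambda)=ai\lambda+\tfrac12b^2\lambda^2-\int_0^\infty(e^{i\lambda x}-1-i\lambda x)\,\nu(dx),\] so that $\mathbb E[e^{i\lambda L_t}]=e^{-t\Psi_L(\lambda)}$. Let $(\sigma_t)_{t\ge0}$ be a (possibly killed) subordinator, not necessarily on the same probability space, with characteristic exponent \[\Psi_\sigma(\lambda)=a-b^2i\lambda-\int_0^\infty(e^{i\lambda x}-1)\,x\nu(dx)=-i\Psi_L'(\lambda).\] Assume (i) $\int_0^\infty(e^{ux}-1-ux)\,\nu(dx)<\infty$ for all $u\in\mathbb R$; and (ii) $\mathrm{Re}\,\Psi_L(\lambda)/|\lambda|\to\infty$ as $|\lambda|\to\infty$. Then $L_1$ has a density $p$, and the process $M_t=\exp(\int_0^t\sigma_s\,ds)\,p(-\sigma_t)\,\mathbf 1\{\sigma_t<\infty\}$ is a non-negative martingale in the natural filtration of $\sigma$.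
   Context: A killed subordinator is set to $+\infty$ at an independent exponential time (here of rate $a$); its characteristic exponent $\Psi_\sigma$ satisfies $\mathbb E[e^{i\lambda\sigma_t}\mathbf 1\{\sigma_t<\infty\}]=e^{-t\Psi_\sigma(\lambda)}$. *)

theory Defs
  imports "HOL-Probability.Probability"
begin

text \<open>Processes are indexed by real time; only times t \<ge> 0 are relevant.\<close>

definition cadlag_path :: "(real \<Rightarrow> 'b::topological_space) \<Rightarrow> bool" where
  "cadlag_path f \<longleftrightarrow>
     (\<forall>t\<ge>0. continuous (at_right t) f) \<and> (\<forall>t>0. \<exists>l. (f \<longlongrightarrow> l) (at_left t))"

definition levy_process :: "'w measure \<Rightarrow> (real \<Rightarrow> 'w \<Rightarrow> real) \<Rightarrow> bool" where
  "levy_process M X \<longleftrightarrow>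
     prob_space M \<and>
     (\<forall>t\<ge>0. X t \<in> borel_measurable M) \<and>
     (\<forall>\<omega>\<in>space M. X 0 \<omega> = 0) \<and>
     (\<forall>\<omega>\<in>space M. cadlag_path (\<lambda>t. X t \<omega>)) \<and>
     (\<forall>(n::nat) (ts::nat \<Rightarrow> real). 0 \<le> ts 0 \<and> (\<forall>i<n. ts i \<le> ts (Suc i)) \<longrightarrow>
        prob_space.indep_vars M (\<lambda>_. borel) (\<lambda>i \<omega>. X (ts (Suc i)) \<omega> - X (ts i) \<omega>) {..<n}) \<and>
     (\<forall>s t. 0 \<le> s \<and> 0 \<le> t \<longrightarrow>
        distr M borel (\<lambda>\<omega>. X (s + t) \<omega> - X s \<omega>) = distr M borel (X t))"

definition subordinator :: "'w measure \<Rightarrow> (real \<Rightarrow> 'w \<Rightarrow> real) \<Rightarrow> bool" where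
  "subordinator M S \<longleftrightarrow> levy_process M S \<and>
     (\<forall>\<omega>\<in>space M. \<forall>s t. 0 \<le> s \<and> s \<le> t \<longrightarrow> S s \<omega> \<le> S t \<omega>)"

text \<open>Subordinator S killed (sent to +\<infinity>) at an independent exponential time
  \<zeta> of rate q (q = 0: no killing, \<zeta> = \<infinity> a.s.).\<close>
definition killed_subordinator :: "'w measure \<Rightarrow> real \<Rightarrow> (real \<Rightarrow> 'w \<Rightarrow> ereal) \<Rightarrow> bool" where
  "killed_subordinator N q \<sigma> \<longleftrightarrow>
     (\<exists>S (\<zeta> :: 'w \<Rightarrow> ereal).
        subordinator N S \<and>
        \<zeta> \<in> borel_measurable N \<and>
        (\<forall>t\<ge>0. measure N {\<omega>\<in>space N. ereal t < \<zeta> \<omega>} = exp (- q * t)) \<and>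
        prob_space.indep_set N
           (sigma_sets (space N) {\<zeta> -` A \<inter> space N | A. A \<in> sets borel})
           (sigma_sets (space N) {S t -` A \<inter> space N | t A. 0 \<le> t \<and> A \<in> sets borel}) \<and>
        (\<forall>\<omega>\<in>space N. \<forall>t\<ge>0. \<sigma> t \<omega> = (if ereal t < \<zeta> \<omega> then ereal (S t \<omega>) else \<infinity>)))"

definition nat_filtration :: "'w measure \<Rightarrow> (real \<Rightarrow> 'w \<Rightarrow> 'b::topological_space) \<Rightarrow> real \<Rightarrow> 'w measure" where
  "nat_filtration N X t =
     sigma (space N) {X s -` A \<inter> space N | s A. 0 \<le> s \<and> s \<le> t \<and> A \<in> sets borel}"

definition martingale :: "'w measure \<Rightarrow> (real \<Rightarrow> 'w measure) \<Rightarrow> (real \<Rightarrow> 'w \<Rightarrow> real) \<Rightarrow> bool" where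
  "martingale N F X \<longleftrightarrow>
     (\<forall>t\<ge>0. integrable N (X t) \<and> X t \<in> borel_measurable (F t)) \<and>
     (\<forall>s t. 0 \<le> s \<and> s \<le> t \<longrightarrow> (AE \<omega> in N. real_cond_exp N (F s) (X t) \<omega> = X s \<omega>))"

end

theory Submission
  imports Defs "HOL-Complex_Analysis.Complex_Analysis"
begin

text \<open>
  Let \<open>\<Phi>(z) = - a z + b\<^sup>2 z\<^sup>2 / 2 + \<integral> (exp (z x) - 1 - z x) \<nu>(dx)\<close>. By (i) this is an entire
  function, and \<open>\<Psi>\<^sub>L(\<lambda>) = - \<Phi>(i \<lambda>)\<close>, \<open>\<Psi>\<^sub>\<sigma>(\<lambda>) = - \<Phi>'(i \<lambda>)\<close>. Hence \<open>\<sigma>\<^sub>t\<close> has all exponential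
  moments, \<open>E[exp (z \<sigma>\<^sub>t); \<sigma>\<^sub>t < \<infinity>] = exp (t \<Phi>'(z))\<close> for all complex \<open>z\<close>, and independence of the
  increments gives, through Riemann sums,
  \<open>E[exp (\<integral>\<^sub>0\<^sup>t \<sigma> + z \<sigma>\<^sub>t); \<sigma>\<^sub>t < \<infinity>] = exp (\<integral>\<^sub>0\<^sup>t \<Phi>'(z + u) du) = exp (\<Phi>(z + t) - \<Phi>(z))\<close>.
  By (ii) the density is \<open>p(x) = 1/(2\<pi>) \<integral> exp (- i \<lambda> x + \<Phi>(i \<lambda>)) d\<lambda>\<close>, so Fubini yields
  \<open>E[exp (\<integral>\<^sub>0\<^sup>t \<sigma>) p(- x - \<sigma>\<^sub>t); \<sigma>\<^sub>t < \<infinity>] = 1/(2\<pi>) \<integral> exp (i \<lambda> x + \<Phi>(i \<lambda> + t)) d\<lambda>\<close>. Moving the line of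
  integration back to \<open>i \<real>\<close> turns this into \<open>exp (- t x) p(- x)\<close>, which together with the Markov
  property is the martingale property.
\<close>

section \<open>The Laplace exponent of the jump part\<close>

text \<open>The laws are known on the imaginary axis only, whereas the argument lives at real
  exponents. The density side crosses this gap by positivity: (exp (u x) - 1) (1 - cos (l x)) is
  nonnegative for u, x >= 0, whence |exp \<Phi>(u + i l)| is at most |exp \<Phi>(u)| |exp \<Phi>(i
  l)|. The decay that (ii) provides on the imaginary axis therefore holds on all lines to its right,
  uniformly over strips of finite width, and this is what justifies both Fubini and the shift of the
  line. Killing is kept apart. The computation is done for the unkilled \<open>S\<close>, whose
  exponent is g = \<Phi>' + a with primitive G = \<Phi> + a z. It leaves a surplus factor exp (a (t
  - s)), which the survival probabilities cancel. The Markov property enters as integration against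
  arbitrary weights measurable for the past of \<open>S\<close>. This is enough for the filtration
  of \<open>\<sigma>\<close>, because on the event that killing comes after s each of its events up
  to time s agrees with an event of the past of \<open>S\<close>.\<close>

lemma exp_sums_power_over_fact:
  fixes y :: "'a::{real_normed_field, banach}"
  shows "(\<lambda>n. y ^ n / fact n) sums exp y"
  using exp_converges[of y] by (simp add: scaleR_conv_of_real field_simps)

lemma exp_tail2_sums:
  fixes y :: "'a::{real_normed_field, banach}"
  shows "(\<lambda>n. if n < 2 then 0 else y ^ n / fact n) sums (exp y - 1 - y)"
proof -
  note exp_sums_power_over_fact[of y]
  moreover have "(\<lambda>n. if n \<in> {..<2} then y ^ n / fact n else 0) sums (\<Sum>n<2. y ^ n / fact n)"
    by (rule sums_If_finite_set) simp
  ultimately have "(\<lambda>n. y ^ n / fact n - (if n \<in> {..<2} then y ^ n / fact n else 0))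
      sums (exp y - (\<Sum>n<2. y ^ n / fact n))"
    by (rule sums_diff)
  also have "(\<lambda>n. y ^ n / fact n - (if n \<in> {..<2} then y ^ n / fact n else 0))
      = (\<lambda>n. if n < 2 then 0 else y ^ n / fact n)" by auto
  also have "exp y - (\<Sum>n<2. y ^ n / fact n) = exp y - 1 - y"
    by (simp add: numeral_2_eq_2)
  finally show ?thesis .
qed

lemma sum_le_exp_tail2:
  fixes y :: real
  assumes "0 \<le> y"
  shows "(\<Sum>n<k. if n < 2 then 0 else y ^ n / fact n) \<le> exp y - 1 - y"
proof -
  have "(\<Sum>n<k. if n < 2 then 0 else y ^ n / fact n)
      \<le> (\<Sum>n. if n < 2 then 0 else y ^ n / fact n)"
    using exp_tail2_sums[of y] assms by (intro sum_le_suminf) (auto simp: sums_iff)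
  then show ?thesis using exp_tail2_sums[of y] by (simp add: sums_iff)
qed

lemma exp_minus_one_sums:
  fixes y :: "'a::{real_normed_field, banach}"
  shows "(\<lambda>n. if n = 0 then 0 else y ^ n / fact n) sums (exp y - 1)"
proof -
  from sums_diff[OF exp_sums_power_over_fact[of y] sums_single[of 0 "\<lambda>n. y ^ n / fact n"]]
  show ?thesis by (simp add: if_distrib cong: if_cong)
qed

locale exp_levy_measure =
  fixes \<nu> :: "real measure"
  assumes sets_nu: "sets \<nu> = sets borel"
    and AE_pos: "AE x in \<nu>. 0 < x"
    and exp_integrable: "\<And>u. integrable \<nu> (\<lambda>x. exp (u * x) - 1 - u * x)"
begin

declare sets_nu [measurable_cong]

definition lap :: "complex \<Rightarrow> complex" where
  "lap z = (\<integral>x. exp (z * of_real x) - 1 - z * of_real x \<partial>\<nu>)"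

text \<open>Given by its own integral because this is the form in which the exponent of
  \<open>\<sigma>\<close> is stated; that it is the derivative of \<open>lap\<close> is a theorem,
  \<open>lap_has_derivative\<close>.\<close>

definition lap' :: "complex \<Rightarrow> complex" where
  "lap' z = (\<integral>x. (exp (z * of_real x) - 1) * of_real x \<partial>\<nu>)"

text \<open>Taylor coefficients of \<open>lap\<close> at 0. The first two vanish because the
  integrand subtracts 1 + z x; \<open>\<nu>\<close> may be infinite near 0, so lower moments have no
  meaning.\<close>

definition lap_coeff :: "nat \<Rightarrow> complex" where
  "lap_coeff n = of_real (if n < 2 then 0 else (\<integral>x. x ^ n \<partial>\<nu>) / fact n)"

text \<open>For x > 0 the quotient of x^n by n! is a single term of the nonnegative series of exp x
  - 1 - x, which is integrable.\<close>

lemma power_integrable: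
  assumes "2 \<le> n"
  shows "integrable \<nu> (\<lambda>x. x ^ n)"
proof (rule Bochner_Integration.integrable_bound)
  show "integrable \<nu> (\<lambda>x. fact n * (exp (1 * x) - 1 - 1 * x))"
    by (intro integrable_mult_right exp_integrable)
  show "AE x in \<nu>. norm (x ^ n) \<le> norm (fact n * (exp (1 * x) - 1 - 1 * x))"
    using AE_pos
  proof eventually_elim
    case (elim x)
    have "x ^ n / fact n = (\<Sum>m\<in>{n}. if m < 2 then 0 else x ^ m / fact m)"
      using assms by simp
    also have "\<dots> \<le> (\<Sum>m<Suc n. if m < 2 then 0 else x ^ m / fact m)"
      using elim by (intro sum_mono2) auto
    also have "\<dots> \<le> exp x - 1 - x"
      using elim by (intro sum_le_exp_tail2) simp
    finally have "x ^ n \<le> fact n * (exp x - 1 - x)" by (simp add: field_simps)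
    moreover have "0 \<le> exp x - 1 - x" using exp_ge_add_one_self[of x] by linarith
    ultimately show ?case using elim by (simp add: abs_mult)
  qed
qed measurable

text \<open>Termwise integration. For x > 0 the norms of the terms sum to the same integrand with
  |z| in place of z, and that one is integrable by assumption.\<close>

lemma lap_sums: "(\<lambda>n. lap_coeff n * z ^ n) sums lap z"
proof -
  define f where "f n x = (if n < 2 then 0 else (z * of_real x) ^ n / fact n)" for n and x :: real
  have f_eq: "f n x = (if n < 2 then 0 else z ^ n / fact n * of_real (x ^ n))" for n x
    by (simp add: f_def power_mult_distrib)
  have int_f: "integrable \<nu> (f n)" for n
    using power_integrable[of n] by (cases "n < 2") (simp_all add: f_eq[abs_def] del: of_real_power)
  have val_f: "(\<integral>x. f n x \<partial>\<nu>) = lap_coeff n * z ^ n" for n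
    by (cases "n < 2") (simp_all add: f_eq[abs_def] lap_coeff_def del: of_real_power)
  have norm_f: "norm (f n x) = (if n < 2 then 0 else (norm z * x) ^ n / fact n)" if "0 < x" for n x
    using that by (simp add: f_def norm_mult norm_divide norm_power)
  have "(\<lambda>n. \<integral>x. f n x \<partial>\<nu>) sums (\<integral>x. (\<Sum>n. f n x) \<partial>\<nu>)"
  proof (rule sums_integral)
    show "integrable \<nu> (f n)" for n by (rule int_f)
    show "AE x in \<nu>. summable (\<lambda>n. norm (f n x))"
      using AE_pos
    proof eventually_elim
      case (elim x)
      show ?case using exp_tail2_sums[of "norm z * x"] by (simp add: norm_f[OF elim] sums_iff)
    qed
    show "summable (\<lambda>n. \<integral>x. norm (f n x) \<partial>\<nu>)"
    proof (rule summableI_nonneg_bounded)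
      fix k
      have "(\<Sum>n<k. \<integral>x. norm (f n x) \<partial>\<nu>) = (\<integral>x. (\<Sum>n<k. norm (f n x)) \<partial>\<nu>)"
        using int_f by (subst Bochner_Integration.integral_sum) auto
      also have "\<dots> \<le> (\<integral>x. exp (norm z * x) - 1 - norm z * x \<partial>\<nu>)"
      proof (rule integral_mono_AE)
        show "AE x in \<nu>. (\<Sum>n<k. norm (f n x)) \<le> exp (norm z * x) - 1 - norm z * x"
          using AE_pos
        proof eventually_elim
          case (elim x)
          then show ?case using sum_le_exp_tail2[of "norm z * x" k] by (simp add: norm_f)
        qed
      qed (use int_f exp_integrable in auto)
      finally show "(\<Sum>n<k. \<integral>x. norm (f n x) \<partial>\<nu>)
          \<le> (\<integral>x. exp (norm z * x) - 1 - norm z * x \<partial>\<nu>)" .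
    qed simp
  qed
  also have "(\<lambda>x. \<Sum>n. f n x) = (\<lambda>x. exp (z * of_real x) - 1 - z * of_real x)"
    using exp_tail2_sums[of "z * of_real _"] by (simp add: f_def sums_iff)
  finally show ?thesis by (simp add: val_f lap_def)
qed

lemma diffs_lap_coeff:
  "diffs lap_coeff n = of_real (if n = 0 then 0 else (\<integral>x. x ^ Suc n \<partial>\<nu>) / fact n)"
  by (auto simp: diffs_def lap_coeff_def field_simps simp del: of_nat_Suc)

text \<open>Integrability of (exp (u x) - 1) x is not at hand to dominate the terms. Instead, since
  x > 0 almost everywhere, the integrals of the norms are the terms of the differentiated series of
  \<open>lap\<close> at |z|, and a power series that converges everywhere may be
  differentiated.\<close>

lemma diffs_lap_coeff_sums: "(\<lambda>n. diffs lap_coeff n * z ^ n) sums lap' z"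
proof -
  define f where "f n x = (if n = 0 then 0 else (z * of_real x) ^ n / fact n) * of_real x"
    for n and x :: real
  have f_eq: "f n x = (if n = 0 then 0 else z ^ n / fact n * of_real (x ^ Suc n))" for n x
    by (simp add: f_def power_mult_distrib)
  have int_f: "integrable \<nu> (f n)" for n
    using power_integrable[of "Suc n"] by (cases "n = 0") (simp_all add: f_eq[abs_def] del: power_Suc of_real_power)
  have val_f: "(\<integral>x. f n x \<partial>\<nu>) = diffs lap_coeff n * z ^ n" for n
    by (cases "n = 0") (simp_all add: f_eq[abs_def] diffs_lap_coeff del: power_Suc of_real_power)
  have "(\<lambda>n. \<integral>x. f n x \<partial>\<nu>) sums (\<integral>x. (\<Sum>n. f n x) \<partial>\<nu>)"
  proof (rule sums_integral)
    show "integrable \<nu> (f n)" for n by (rule int_f)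
    show "AE x in \<nu>. summable (\<lambda>n. norm (f n x))"
    proof (rule AE_I2)
      fix x
      have "summable (\<lambda>n. (if n = 0 then 0 else (norm z * \<bar>x\<bar>) ^ n / fact n) * \<bar>x\<bar>)"
        using exp_minus_one_sums[of "norm z * \<bar>x\<bar>"] by (intro summable_mult2) (simp add: sums_iff)
      also have "(\<lambda>n. (if n = 0 then 0 else (norm z * \<bar>x\<bar>) ^ n / fact n) * \<bar>x\<bar>) = (\<lambda>n. norm (f n x))"
        by (auto simp: f_def norm_mult norm_divide norm_power)
      finally show "summable (\<lambda>n. norm (f n x))" .
    qed
    have "summable (\<lambda>n. diffs lap_coeff n * of_real (norm z) ^ n)"
      using lap_sums by (intro termdiff_converges_all) (simp add: sums_iff)
    also have "(\<lambda>n. diffs lap_coeff n * of_real (norm z) ^ n)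
        = (\<lambda>n. complex_of_real (\<integral>x. norm (f n x) \<partial>\<nu>))"
    proof
      fix n
      have "(\<integral>x. norm (f n x) \<partial>\<nu>) = (\<integral>x. (if n = 0 then 0 else norm z ^ n / fact n * x ^ Suc n) \<partial>\<nu>)"
      proof (rule integral_cong_AE)
        show "AE x in \<nu>. norm (f n x) = (if n = 0 then 0 else norm z ^ n / fact n * x ^ Suc n)"
          using AE_pos
          by eventually_elim (auto simp: f_eq norm_mult norm_divide norm_power)
      qed (simp_all add: f_eq[abs_def])
      then show "diffs lap_coeff n * of_real (norm z) ^ n = complex_of_real (\<integral>x. norm (f n x) \<partial>\<nu>)"
        by (simp add: diffs_lap_coeff del: power_Suc)
    qed
    finally show "summable (\<lambda>n. \<integral>x. norm (f n x) \<partial>\<nu>)"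
      by (simp add: summable_complex_of_real)
  qed
  also have "(\<lambda>x. \<Sum>n. f n x) = (\<lambda>x. (exp (z * of_real x) - 1) * of_real x)"
  proof
    fix x
    show "(\<Sum>n. f n x) = (exp (z * of_real x) - 1) * of_real x"
      using sums_mult2[OF exp_minus_one_sums[of "z * of_real x"], of "of_real x"]
      by (simp add: f_def sums_iff)
  qed
  finally show ?thesis by (simp add: val_f lap'_def)
qed

lemma lap_has_derivative: "(lap has_field_derivative lap' z) (at z)"
proof -
  have "((\<lambda>z. \<Sum>n. lap_coeff n * z ^ n) has_field_derivative (\<Sum>n. diffs lap_coeff n * z ^ n)) (at z)"
    using lap_sums by (intro termdiffs_strong_converges_everywhere) (simp add: sums_iff)
  moreover have "(\<lambda>z. \<Sum>n. lap_coeff n * z ^ n) = lap"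
    using lap_sums by (simp add: sums_iff fun_eq_iff)
  moreover have "(\<Sum>n. diffs lap_coeff n * z ^ n) = lap' z"
    using diffs_lap_coeff_sums by (simp add: sums_iff)
  ultimately show ?thesis by simp
qed

lemma lap_integrable:
  fixes z :: complex
  shows "integrable \<nu> (\<lambda>x. exp (z * of_real x) - 1 - z * of_real x)"
proof (rule Bochner_Integration.integrable_bound[OF exp_integrable[of "norm z"]])
  show "AE x in \<nu>. norm (exp (z * of_real x) - 1 - z * of_real x)
      \<le> norm (exp (norm z * x) - 1 - norm z * x)"
    using AE_pos
  proof eventually_elim
    case (elim x)
    have "norm (exp (z * of_real x) - 1 - z * of_real x)
        = norm (\<Sum>n. if n < 2 then 0 else (z * of_real x) ^ n / fact n)"
      using exp_tail2_sums[of "z * of_real x"] by (simp add: sums_iff)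
    also have "\<dots> \<le> (\<Sum>n. if n < 2 then 0 else (norm z * x) ^ n / fact n)"
      using exp_tail2_sums[of "norm z * x"] elim
      by (intro norm_suminf_le) (auto simp: sums_iff norm_mult norm_divide norm_power)
    also have "\<dots> = exp (norm z * x) - 1 - norm z * x"
      using exp_tail2_sums[of "norm z * x"] by (simp add: sums_iff)
    finally show ?case by simp
  qed
qed measurable

text \<open>Pointwise, right side minus left side equals (exp (u x) - 1) (1 - cos (l x)), which is
  nonnegative for u, x >= 0. This estimate controls the transform on a vertical line by its values
  on the imaginary axis.\<close>

lemma Re_lap_le:
  assumes "0 \<le> u"
  shows "Re (lap ((of_real u + \<i> * of_real l))) \<le> Re (lap (of_real u)) + Re (lap (\<i> * of_real l))"
proof -
  have Re_lap: "Re (lap z) = (\<integral>x. Re (exp (z * of_real x) - 1 - z * of_real x) \<partial>\<nu>)" for z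
    unfolding lap_def by (rule integral_Re[symmetric]) (rule lap_integrable)
  have "Re (lap ((of_real u + \<i> * of_real l))) \<le> (\<integral>x. Re (exp (of_real u * of_real x) - 1 - of_real u * of_real x)
      + Re (exp (\<i> * of_real l * of_real x) - 1 - \<i> * of_real l * of_real x) \<partial>\<nu>)"
    unfolding Re_lap
  proof (rule integral_mono_AE)
    show "AE x in \<nu>. Re (exp ((of_real u + \<i> * of_real l) * of_real x) - 1 - (of_real u + \<i> * of_real l) * of_real x)
        \<le> Re (exp (of_real u * of_real x) - 1 - of_real u * of_real x)
          + Re (exp (\<i> * of_real l * of_real x) - 1 - \<i> * of_real l * of_real x)"
      using AE_pos
    proof eventually_elim
      case (elim x)
      have "0 \<le> (exp (u * x) - 1) * (1 - cos (l * x))"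
        using elim assms by (intro mult_nonneg_nonneg) auto
      then show ?case by (simp add: Re_exp algebra_simps)
    qed
  qed (intro Bochner_Integration.integrable_add integrable_Re lap_integrable)+
  also have "\<dots> = Re (lap (of_real u)) + Re (lap (\<i> * of_real l))"
    unfolding Re_lap using lap_integrable
    by (intro Bochner_Integration.integral_add integrable_Re lap_integrable)
  finally show ?thesis .
qed

end

section \<open>Laplace transforms with entire extension\<close>

text \<open>Exchange of integral and exponential series under the majorant |W| exp (r |X|). The
  weight \<open>W\<close> allows an expansion around any centre: exp (z0 X) yields holomorphy near
  z0, and exp (- X) gives Taylor coefficients at -1.\<close>

lemma weighted_exp_integral_sums:
  fixes X :: "'a \<Rightarrow> real" and W :: "'a \<Rightarrow> complex" and w :: complex
  assumes [measurable]: "X \<in> borel_measurable M" "W \<in> borel_measurable M"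
    and int: "integrable M (\<lambda>x. norm (W x) * exp (r * \<bar>X x\<bar>))"
    and w: "norm w \<le> r"
  shows "(\<lambda>n. (\<integral>x. W x * of_real (X x ^ n / fact n) \<partial>M) * w ^ n) sums
    (\<integral>x. W x * exp (w * of_real (X x)) \<partial>M)"
proof -
  define f where "f n x = W x * ((w * of_real (X x)) ^ n / fact n)" for n x
  have norm_f: "norm (f n x) = norm (W x) * ((norm w * \<bar>X x\<bar>) ^ n / fact n)" for n x
    by (simp add: f_def norm_mult norm_divide norm_power)
  have sum_le: "(\<Sum>n<k. norm (f n x)) \<le> norm (W x) * exp (r * \<bar>X x\<bar>)" for k x
  proof -
    have "(\<Sum>n<k. (norm w * \<bar>X x\<bar>) ^ n / fact n) \<le> (\<Sum>n. (norm w * \<bar>X x\<bar>) ^ n / fact n)"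
      using exp_sums_power_over_fact[of "norm w * \<bar>X x\<bar>"] by (intro sum_le_suminf) (auto simp: sums_iff)
    also have "\<dots> = exp (norm w * \<bar>X x\<bar>)"
      using exp_sums_power_over_fact[of "norm w * \<bar>X x\<bar>"] by (simp add: sums_iff)
    also have "\<dots> \<le> exp (r * \<bar>X x\<bar>)"
      using w by (simp add: mult_right_mono)
    finally show ?thesis
      unfolding norm_f sum_distrib_left[symmetric] by (intro mult_left_mono) auto
  qed
  have int_f: "integrable M (f n)" for n
  proof (rule Bochner_Integration.integrable_bound[OF int])
    show "AE x in M. norm (f n x) \<le> norm (norm (W x) * exp (r * \<bar>X x\<bar>))"
    proof (rule AE_I2)
      fix x
      have "norm (f n x) \<le> (\<Sum>n<Suc n. norm (f n x))"
        by (rule member_le_sum) auto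
      also note sum_le
      finally show "norm (f n x) \<le> norm (norm (W x) * exp (r * \<bar>X x\<bar>))" by simp
    qed
  qed (simp add: f_def[abs_def])
  have "(\<lambda>n. \<integral>x. f n x \<partial>M) sums (\<integral>x. (\<Sum>n. f n x) \<partial>M)"
  proof (rule sums_integral)
    show "integrable M (f n)" for n by (rule int_f)
    show "AE x in M. summable (\<lambda>n. norm (f n x))"
      unfolding norm_f using exp_sums_power_over_fact by (intro AE_I2 summable_mult) (auto simp: sums_iff)
    show "summable (\<lambda>n. \<integral>x. norm (f n x) \<partial>M)"
    proof (rule summableI_nonneg_bounded)
      fix k
      have "(\<Sum>n<k. \<integral>x. norm (f n x) \<partial>M) = (\<integral>x. (\<Sum>n<k. norm (f n x)) \<partial>M)"
        using int_f by (subst Bochner_Integration.integral_sum) auto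
      also have "\<dots> \<le> (\<integral>x. norm (W x) * exp (r * \<bar>X x\<bar>) \<partial>M)"
        using int_f int sum_le by (intro integral_mono) auto
      finally show "(\<Sum>n<k. \<integral>x. norm (f n x) \<partial>M) \<le> (\<integral>x. norm (W x) * exp (r * \<bar>X x\<bar>) \<partial>M)" .
    qed simp
  qed
  also have "(\<lambda>x. \<Sum>n. f n x) = (\<lambda>x. W x * exp (w * of_real (X x)))"
    using sums_mult[OF exp_sums_power_over_fact[of "w * of_real (X _)"]] by (auto simp: f_def sums_iff)
  also have "(\<lambda>n. \<integral>x. f n x \<partial>M) = (\<lambda>n. (\<integral>x. W x * of_real (X x ^ n / fact n) \<partial>M) * w ^ n)"
  proof
    fix n
    have "f n x = (W x * of_real (X x ^ n / fact n)) * w ^ n" for x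
      by (simp add: f_def power_mult_distrib)
    then show "(\<integral>x. f n x \<partial>M) = (\<integral>x. W x * of_real (X x ^ n / fact n) \<partial>M) * w ^ n"
      by simp
  qed
  finally show ?thesis .
qed

lemma exp_integral_holomorphic_ball:
  fixes X :: "'a \<Rightarrow> real"
  assumes [measurable]: "X \<in> borel_measurable M"
    and int: "integrable M (\<lambda>x. exp (Re z0 * X x + r * \<bar>X x\<bar>))"
  shows "(\<lambda>z. \<integral>x. exp (z * of_real (X x)) \<partial>M) holomorphic_on ball z0 r"
proof (rule power_series_holomorphic)
  fix w assume "w \<in> ball z0 r"
  then have w: "norm (w - z0) \<le> r" by (simp add: dist_norm norm_minus_commute)
  have W: "(\<lambda>x. exp (z0 * of_real (X x))) \<in> borel_measurable M" by measurable
  have "integrable M (\<lambda>x. norm (exp (z0 * of_real (X x))) * exp (r * \<bar>X x\<bar>))"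
    using int by (simp add: exp_add)
  from weighted_exp_integral_sums[OF assms(1) W this w]
  have "(\<lambda>n. (\<integral>x. exp (z0 * of_real (X x)) * of_real (X x ^ n / fact n) \<partial>M) * (w - z0) ^ n) sums
    (\<integral>x. exp (z0 * of_real (X x)) * exp ((w - z0) * of_real (X x)) \<partial>M)" .
  moreover have "exp (z0 * of_real (X x)) * exp ((w - z0) * of_real (X x)) = exp (w * of_real (X x))" for x
    by (subst mult_exp_exp) (simp add: algebra_simps)
  ultimately show "(\<lambda>n. (\<integral>x. exp (z0 * of_real (X x)) * of_real (X x ^ n / fact n) \<partial>M) * (w - z0) ^ n) sums
    (\<integral>x. exp (w * of_real (X x)) \<partial>M)"
    by (simp only:)
qed

context prob_space
begin

text \<open>The Laplace transform of \<open>X\<close> on the half plane \<open>Re z < 0\<close> and the entire function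
  \<open>g\<close> agree on the boundary, so they are equal. The Taylor coefficients of \<open>g\<close> at \<open>-1\<close> are then
  non-negative, and their summability is the finiteness of all exponential moments of \<open>X\<close>.\<close>

lemma laplace_transform_eq_entire:
  fixes X :: "'a \<Rightarrow> real" and g :: "complex \<Rightarrow> complex"
  assumes [measurable]: "X \<in> borel_measurable M"
    and nonneg: "\<And>\<omega>. \<omega> \<in> space M \<Longrightarrow> 0 \<le> X \<omega>"
    and hol: "g holomorphic_on UNIV"
    and char: "\<And>l::real. (\<integral>\<omega>. exp (\<i> * of_real l * of_real (X \<omega>)) \<partial>M) = g (\<i> * of_real l)"
  shows "integrable M (\<lambda>\<omega>. exp (z * of_real (X \<omega>)))"
    and "(\<integral>\<omega>. exp (z * of_real (X \<omega>)) \<partial>M) = g z"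
proof -
  define f where "f z = (\<integral>\<omega>. exp (z * of_real (X \<omega>)) \<partial>M)" for z :: complex
  have le_1: "exp (u * X \<omega>) \<le> 1" if "u \<le> 0" "\<omega> \<in> space M" for u \<omega>
    using that nonneg[of \<omega>] by (simp add: mult_nonpos_nonneg)
  have int_nonpos: "integrable M (\<lambda>\<omega>. exp (u * X \<omega>))" if "u \<le> 0" for u
    using le_1[OF that] by (intro integrable_const_bound[where B=1]) auto
  have hol_f: "f holomorphic_on {z. Re z < 0}"
  unfolding holomorphic_on_def
  proof (rule ballI)
    fix z assume z: "z \<in> {z. Re z < 0}"
    \<comment> \<open>Since X >= 0, the exponent is 0 for the radius - Re z, the distance to the
      imaginary axis; so no moment of X is involved.\<close>
    have "integrable M (\<lambda>\<omega>. exp (Re z * X \<omega> + (- Re z) * \<bar>X \<omega>\<bar>))"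
    proof (rule integrable_const_bound[where B=1])
      show "AE \<omega> in M. norm (exp (Re z * X \<omega> + (- Re z) * \<bar>X \<omega>\<bar>)) \<le> 1"
        by (rule AE_I2) (simp add: nonneg)
    qed simp
    then have "f holomorphic_on ball z (- Re z)"
      unfolding f_def[abs_def] by (intro exp_integral_holomorphic_ball) auto
    then show "f field_differentiable at z within {z. Re z < 0}"
      using z holomorphic_on_imp_differentiable_at[of f "ball z (- Re z)" z]
      by (simp add: field_differentiable_at_within)
  qed
  have cont_f: "continuous_on {z. Re z \<le> 0} f"
  proof (rule continuous_on_sequentiallyI)
    fix u z assume u: "\<forall>n. u n \<in> {z. Re z \<le> 0}" and z: "z \<in> {z. Re z \<le> 0}" and lim: "u \<longlonglongrightarrow> z"
    show "(\<lambda>n. f (u n)) \<longlonglongrightarrow> f z"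
      unfolding f_def
    proof (rule integral_dominated_convergence[where w="\<lambda>_. 1"])
      show "AE \<omega> in M. (\<lambda>n. exp (u n * of_real (X \<omega>))) \<longlonglongrightarrow> exp (z * of_real (X \<omega>))"
        by (intro AE_I2 tendsto_intros lim)
      show "AE \<omega> in M. norm (exp (u n * of_real (X \<omega>))) \<le> 1" for n
        using u le_1[of "Re (u n)"] by (intro AE_I2) auto
    qed auto
  qed
  \<comment> \<open>The difference extended by 0 across the axis. It is continuous because f and g
    agree there, holomorphic on both sides, hence entire; being 0 on the right half plane it is 0
    everywhere.\<close>
  define h where "h z = (if Re z \<le> 0 then f z - g z else 0)" for z
  have closed: "closed {z. Re z \<le> 0}" "closed {z. 0 \<le> Re z}"
    by (simp_all add: closed_halfspace_Re_le closed_halfspace_Re_ge)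
  have "continuous_on ({z. Re z \<le> 0} \<union> {z. 0 \<le> Re z}) h"
    unfolding h_def[abs_def]
  proof (rule continuous_on_cases[OF closed])
    show "continuous_on {z. Re z \<le> 0} (\<lambda>z. f z - g z)"
      using hol by (intro continuous_intros cont_f)
        (auto intro: holomorphic_on_imp_continuous_on continuous_on_subset)
    have "f z = g z" if "Re z = 0" for z
    proof -
      have "z = \<i> * of_real (Im z)" using that by (simp add: complex_eq_iff)
      then show ?thesis using char[of "Im z"] by (simp add: f_def)
    qed
    then show "\<forall>z. (z \<in> {z. Re z \<le> 0} \<and> \<not> Re z \<le> 0) \<or> (z \<in> {z. 0 \<le> Re z} \<and> Re z \<le> 0) \<longrightarrow> f z - g z = 0"
      by auto
  qed auto
  also have "{z. Re z \<le> 0} \<union> {z. 0 \<le> Re z} = UNIV" by auto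
  finally have cont_h: "continuous_on UNIV h" .
  have "h holomorphic_on UNIV"
  proof (rule holomorphic_on_paste_across_line[where d=1 and k=0])
    have "(\<lambda>z. f z - g z) holomorphic_on {z. Re z < 0}"
      using hol by (intro holomorphic_intros hol_f) (auto intro: holomorphic_on_subset)
    then show "h holomorphic_on (UNIV \<inter> {z. 1 \<bullet> z < 0})"
      by (rule holomorphic_transform[THEN holomorphic_on_subset]) (auto simp: h_def inner_complex_def)
    have "(\<lambda>z. 0) holomorphic_on {z. 0 < Re z}" by simp
    then show "h holomorphic_on (UNIV \<inter> {z. 0 < 1 \<bullet> z})"
      by (rule holomorphic_transform[THEN holomorphic_on_subset]) (auto simp: h_def inner_complex_def)
  qed (use cont_h in auto)
  then have h0: "h z = 0" for z
    using analytic_continuation_open[of "{z. 0 < Re z}" UNIV h "\<lambda>_. 0" z]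
    by (force simp: open_halfspace_Re_gt h_def intro: exI[of _ 1])
  have fg: "f z = g z" if "Re z \<le> 0" for z
    using h0[of z] that by (simp add: h_def)

  \<comment> \<open>The centre -1 lies inside the half plane where f and g are known to agree. The
    weight exp (- X) makes every coefficient finite; X >= 0 makes it nonnegative. \<open>a\<close>
    is the same sequence in complex form.\<close>
  define \<alpha> where "\<alpha> n = (\<integral>\<omega>. exp (- X \<omega>) * (X \<omega> ^ n / fact n) \<partial>M)" for n
  define a where "a n = (\<integral>\<omega>. exp (- of_real (X \<omega>)) * complex_of_real (X \<omega> ^ n / fact n) \<partial>M)" for n
  have a_eq: "a n = of_real (\<alpha> n)" for n
  proof -
    have "exp (- of_real y) * complex_of_real (y ^ n / fact n) = of_real (exp (- y) * (y ^ n / fact n))" for y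
      by (simp flip: exp_of_real)
    then show ?thesis
      unfolding a_def \<alpha>_def by (simp only: integral_complex_of_real)
  qed
  define b where "b n = (deriv ^^ n) g (- 1) / fact n" for n
  have b_sums: "(\<lambda>n. b n * w ^ n) sums g (w - 1)" for w
  proof -
    have "g holomorphic_on ball (-1) (norm w + 1)" using hol holomorphic_on_subset by blast
    then show ?thesis
      using holomorphic_power_series[of g "-1" "norm w + 1" "w - 1"]
      by (simp add: b_def dist_norm)
  qed
  have a_sums: "(\<lambda>n. a n * w ^ n) sums g (w - 1)" if "norm w < 1" for w
  proof -
    have W: "(\<lambda>\<omega>. exp (- of_real (X \<omega>)) :: complex) \<in> borel_measurable M" by measurable
    have "integrable M (\<lambda>\<omega>. norm (exp (- of_real (X \<omega>) :: complex)) * exp (1 * \<bar>X \<omega>\<bar>))"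
    proof (rule integrable_const_bound[where B=1])
      show "AE \<omega> in M. norm (norm (exp (- of_real (X \<omega>) :: complex)) * exp (1 * \<bar>X \<omega>\<bar>)) \<le> 1"
        by (rule AE_I2) (simp add: nonneg flip: exp_add)
    qed simp
    from weighted_exp_integral_sums[OF assms(1) W this, of w] that
    have "(\<lambda>n. a n * w ^ n) sums (\<integral>\<omega>. exp (- of_real (X \<omega>)) * exp (w * of_real (X \<omega>)) \<partial>M)"
      by (simp add: a_def)
    also have "\<dots> = f (w - 1)"
      unfolding f_def by (subst mult_exp_exp) (simp add: algebra_simps)
    also have "\<dots> = g (w - 1)"
      using that abs_Re_le_cmod[of w] by (intro fg) auto
    finally show ?thesis .
  qed
  have "(\<lambda>w. g (w - 1)) has_fps_expansion Abs_fps a"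
    using a_sums by (intro has_fps_expansionI eventually_nhds_in_open[of "ball 0 1", THEN eventually_mono]) auto
  moreover have "(\<lambda>w. g (w - 1)) has_fps_expansion Abs_fps b"
    using b_sums by (intro has_fps_expansionI always_eventually) auto
  \<comment> \<open>The moments represent g on the unit disc around -1 only, the derivatives of g on
    the whole plane. Uniqueness of the expansion gives the moment series an infinite radius of
    convergence.\<close>
  ultimately have "Abs_fps a = Abs_fps b"
    by (rule fps_expansion_unique_complex)
  then have ab: "a = b" by (simp add: Abs_fps_inject)
  have \<alpha>_nonneg: "0 \<le> \<alpha> n" for n
    unfolding \<alpha>_def using nonneg by (intro integral_nonneg_AE AE_I2) auto
  have summ: "summable (\<lambda>n. \<alpha> n * r ^ n)" for r
  proof -
    have "summable (\<lambda>n. complex_of_real (\<alpha> n * r ^ n))"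
      using b_sums[of "of_real r"] by (simp add: ab[symmetric] a_eq sums_iff)
    then show ?thesis by (simp only: summable_complex_of_real)
  qed
  \<comment> \<open>Monotone convergence: all terms are nonnegative, so integrating the series of
    exp (r X) against exp (- X) gives the finite sum of the \<alpha> n r^n. The exponent u is later
    reached with r = u + 1.\<close>
  have int_pos: "integrable M (\<lambda>\<omega>. exp (- X \<omega>) * exp (r * X \<omega>))" if r: "0 \<le> r" for r
  proof (rule integrableI_bounded)
    have int_term: "integrable M (\<lambda>\<omega>. exp (- X \<omega>) * (X \<omega> ^ n / fact n))" for n
    proof (rule integrable_const_bound[where B=1])
      show "AE \<omega> in M. norm (exp (- X \<omega>) * (X \<omega> ^ n / fact n)) \<le> 1"
      proof (rule AE_I2)
        fix \<omega> assume "\<omega> \<in> space M"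
        then have "0 \<le> X \<omega>" by (rule nonneg)
        moreover have "X \<omega> ^ n / fact n \<le> exp (X \<omega>)"
          using calculation exp_converges[of "X \<omega>"] sum_le_suminf[of "\<lambda>n. X \<omega> ^ n / fact n" "{n}"]
          by (simp add: sums_iff field_simps)
        ultimately show "norm (exp (- X \<omega>) * (X \<omega> ^ n / fact n)) \<le> 1"
          by (simp add: exp_minus field_simps)
      qed
    qed simp
    have "(\<integral>\<^sup>+\<omega>. norm (exp (- X \<omega>) * exp (r * X \<omega>)) \<partial>M)
        = (\<integral>\<^sup>+\<omega>. (\<Sum>n. ennreal (r ^ n * (exp (- X \<omega>) * (X \<omega> ^ n / fact n)))) \<partial>M)"
    proof (rule nn_integral_cong)
      fix \<omega> assume "\<omega> \<in> space M"
      then have "0 \<le> X \<omega>" by (rule nonneg)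
      have "(\<lambda>n. exp (- X \<omega>) * ((r * X \<omega>) ^ n /\<^sub>R fact n)) sums (exp (- X \<omega>) * exp (r * X \<omega>))"
        by (intro sums_mult exp_converges)
      then have "(\<lambda>n. r ^ n * (exp (- X \<omega>) * (X \<omega> ^ n / fact n))) sums (exp (- X \<omega>) * exp (r * X \<omega>))"
        by (simp add: power_mult_distrib field_simps)
      then show "ennreal (norm (exp (- X \<omega>) * exp (r * X \<omega>)))
          = (\<Sum>n. ennreal (r ^ n * (exp (- X \<omega>) * (X \<omega> ^ n / fact n))))"
        using \<open>0 \<le> X \<omega>\<close> r by (subst suminf_ennreal_eq[of _ "exp (- X \<omega>) * exp (r * X \<omega>)"]) auto
    qed
    also have "\<dots> = (\<Sum>n. \<integral>\<^sup>+\<omega>. ennreal (r ^ n * (exp (- X \<omega>) * (X \<omega> ^ n / fact n))) \<partial>M)"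
      by (rule nn_integral_suminf) auto
    also have "\<dots> = (\<Sum>n. ennreal (\<alpha> n * r ^ n))"
    proof (rule suminf_cong)
      fix n
      have "(\<integral>\<^sup>+\<omega>. ennreal (r ^ n * (exp (- X \<omega>) * (X \<omega> ^ n / fact n))) \<partial>M)
          = ennreal (\<integral>\<omega>. r ^ n * (exp (- X \<omega>) * (X \<omega> ^ n / fact n)) \<partial>M)"
        using int_term nonneg r by (intro nn_integral_eq_integral integrable_mult_right AE_I2) auto
      also have "(\<integral>\<omega>. r ^ n * (exp (- X \<omega>) * (X \<omega> ^ n / fact n)) \<partial>M) = \<alpha> n * r ^ n"
        unfolding \<alpha>_def by (subst integral_mult_right_zero) simp
      finally show "(\<integral>\<^sup>+\<omega>. ennreal (r ^ n * (exp (- X \<omega>) * (X \<omega> ^ n / fact n))) \<partial>M) = ennreal (\<alpha> n * r ^ n)" .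
    qed
    also have "\<dots> = ennreal (\<Sum>n. \<alpha> n * r ^ n)"
      using \<alpha>_nonneg r by (intro suminf_ennreal2 summ) auto
    also have "\<dots> < \<infinity>" by simp
    finally show "(\<integral>\<^sup>+\<omega>. norm (exp (- X \<omega>) * exp (r * X \<omega>)) \<partial>M) < \<infinity>" .
  qed simp
  have int_all: "integrable M (\<lambda>\<omega>. exp (u * X \<omega>))" for u
  proof (cases "u \<le> 0")
    case False
    then show ?thesis using int_pos[of "u + 1"]
      by (simp add: distrib_right flip: exp_add)
  qed (rule int_nonpos)
  show "integrable M (\<lambda>\<omega>. exp (z * of_real (X \<omega>)))"
    using int_all[of "Re z"] by (rule Bochner_Integration.integrable_bound) auto
  have "f holomorphic_on UNIV"
  unfolding holomorphic_on_def
  proof (rule ballI)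
    fix z :: complex
    have "integrable M (\<lambda>\<omega>. exp (Re z * X \<omega> + 1 * \<bar>X \<omega>\<bar>))
        \<longleftrightarrow> integrable M (\<lambda>\<omega>. exp ((Re z + 1) * X \<omega>))"
      by (rule Bochner_Integration.integrable_cong) (simp_all add: nonneg distrib_right)
    with int_all[of "Re z + 1"] have "f holomorphic_on ball z 1"
      unfolding f_def[abs_def] by (intro exp_integral_holomorphic_ball) auto
    then show "f field_differentiable at z within UNIV"
      by (intro holomorphic_on_imp_differentiable_at) auto
  qed
  then have "f z = g z"
    using hol fg analytic_continuation_open[of "{z. Re z < 0}" UNIV f g z]
    by (force simp: open_halfspace_Re_lt intro: exI[of _ "-1"])
  then show "(\<integral>\<omega>. exp (z * of_real (X \<omega>)) \<partial>M) = g z" by (simp add: f_def)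
qed

end

section \<open>Contour shift and Fourier inversion\<close>

text \<open>A primitive P takes the place of a rectangular contour. The integral over [-n, n] on a
  vertical line is - i times an increment of P, so two lines differ by two horizontal increments of
  P at heights n and - n. The mean value inequality bounds these by t B(n) and t B(- n), which tend
  to 0.\<close>

lemma vertical_line_integral_shift:
  fixes H :: "complex \<Rightarrow> complex" and B :: "real \<Rightarrow> real"
  assumes hol: "H holomorphic_on UNIV" and t: "0 \<le> t"
    and bound: "\<And>u l. 0 \<le> u \<Longrightarrow> u \<le> t \<Longrightarrow> norm (H (of_real u + \<i> * of_real l)) \<le> B l"
    and int_B: "integrable lborel B" and lim_B: "(B \<longlongrightarrow> 0) at_infinity"
  shows "(\<integral>l. H (of_real t + \<i> * of_real l) \<partial>lborel) = (\<integral>l. H (\<i> * of_real l) \<partial>lborel)"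
proof -
  obtain P where P: "(P has_field_derivative H z) (at z)" for z
    using holomorphic_convex_primitive'[of UNIV H] hol by auto
  have cont: "continuous_on UNIV H" using hol by (rule holomorphic_on_imp_continuous_on)
  have cont_line: "continuous_on UNIV (\<lambda>l. H (of_real u + \<i> * of_real l))" for u
    by (intro continuous_on_compose2[OF cont] continuous_intros) auto
  have meas: "(\<lambda>l. H (of_real u + \<i> * of_real l)) \<in> borel_measurable borel" for u
    using cont_line by (rule borel_measurable_continuous_onI)
  define J where "J u n = (\<integral>l. indicator {- real n..real n} l *\<^sub>R H (of_real u + \<i> * of_real l) \<partial>lborel)"
    for u :: real and n :: nat
  have J_eq: "J u n = - \<i> * P (of_real u + \<i> * of_real n) + \<i> * P (of_real u - \<i> * of_real n)" for u n
  proof -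
    have "has_bochner_integral lborel
        (\<lambda>l. indicator {- real n..real n} l *\<^sub>R H (of_real u + \<i> * of_real l))
        (- \<i> * P (of_real u + \<i> * of_real (real n)) - (- \<i> * P (of_real u + \<i> * of_real (- real n))))"
    proof (rule has_bochner_integral_FTC_Icc)
      fix l :: real
      have "((\<lambda>l. - \<i> * P (of_real u + \<i> * l)) has_field_derivative H (of_real u + \<i> * of_real l)) (at (of_real l))"
        by (rule derivative_eq_intros DERIV_chain2[OF P] refl)+ (simp add: mult.assoc)
      then show "((\<lambda>l. - \<i> * P (of_real u + \<i> * of_real l)) has_vector_derivative H (of_real u + \<i> * of_real l))
          (at l within {- real n..real n})"
        by (rule has_vector_derivative_at_within[OF has_vector_derivative_real_field])
    qed (use continuous_on_subset[OF cont_line] in auto)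
    then show ?thesis unfolding J_def by (simp add: has_bochner_integral_iff)
  qed
  have lim_J: "J u \<longlonglongrightarrow> (\<integral>l. H (of_real u + \<i> * of_real l) \<partial>lborel)" if "0 \<le> u" "u \<le> t" for u
    unfolding J_def
  proof (rule integral_dominated_convergence[where w=B])
    show "AE l in lborel. (\<lambda>n. indicator {- real n..real n} l *\<^sub>R H (of_real u + \<i> * of_real l))
        \<longlonglongrightarrow> H (of_real u + \<i> * of_real l)"
    proof (rule AE_I2, rule tendsto_eventually)
      fix l :: real
      show "\<forall>\<^sub>F n in sequentially. indicator {- real n..real n} l *\<^sub>R H (of_real u + \<i> * of_real l)
          = H (of_real u + \<i> * of_real l)"
        using eventually_ge_at_top[of "nat \<lceil>\<bar>l\<bar>\<rceil>"]
        by eventually_elim (auto simp: indicator_def)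
    qed
    show "AE l in lborel. norm (indicator {- real n..real n} l *\<^sub>R H (of_real u + \<i> * of_real l)) \<le> B l" for n
      using bound[OF that] order_trans[OF norm_ge_zero bound[OF that]]
      by (intro AE_I2) (simp add: indicator_def)
  qed (use meas int_B in auto)
  have P_diff: "norm (P (of_real t + \<i> * of_real l) - P (\<i> * of_real l)) \<le> B l * t" for l
  proof -
    have "norm (P (of_real t + \<i> * of_real l) - P (\<i> * of_real l))
        \<le> B l * norm ((of_real t + \<i> * of_real l) - \<i> * of_real l)"
    proof (rule field_differentiable_bound[where f'=H and S="closed_segment (\<i> * of_real l) (of_real t + \<i> * of_real l)"])
      fix z assume "z \<in> closed_segment (\<i> * of_real l) (of_real t + \<i> * of_real l)"
      then obtain v where v: "0 \<le> v" "v \<le> 1" "z = (1 - v) *\<^sub>R (\<i> * of_real l) + v *\<^sub>R (of_real t + \<i> * of_real l)"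
        by (auto simp: in_segment)
      have "z = of_real (v * t) + \<i> * of_real l"
        unfolding v(3) by (simp add: scaleR_conv_of_real algebra_simps)
      moreover have "v * t \<le> t" using v t by (simp add: mult_left_le_one_le)
      ultimately show "norm (H z) \<le> B l" using bound[of "v * t" l] v t by simp
      show "(P has_field_derivative H z) (at z within closed_segment (\<i> * of_real l) (of_real t + \<i> * of_real l))"
        by (rule has_field_derivative_at_within[OF P])
    qed auto
    then show ?thesis using t by simp
  qed
  have "(\<lambda>n. J t n - J 0 n) \<longlonglongrightarrow> 0"
  proof (rule Lim_null_comparison)
    show "\<forall>\<^sub>F n in sequentially. norm (J t n - J 0 n) \<le> B (real n) * t + B (- real n) * t"
    proof (rule always_eventually, rule allI)
      fix n
      have "J t n - J 0 n = - \<i> * (P (of_real t + \<i> * of_real (real n)) - P (\<i> * of_real (real n)))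
          + \<i> * (P (of_real t + \<i> * of_real (- real n)) - P (\<i> * of_real (- real n)))"
        by (simp add: J_eq algebra_simps)
      also have "norm \<dots> \<le> B (real n) * t + B (- real n) * t"
        using P_diff[of "real n"] P_diff[of "- real n"]
        by (intro norm_triangle_le add_mono) (auto simp: norm_mult)
      finally show "norm (J t n - J 0 n) \<le> B (real n) * t + B (- real n) * t" .
    qed
    have "filterlim real at_infinity sequentially"
      using filterlim_real_sequentially filterlim_at_top_imp_at_infinity by blast
    moreover have "filterlim (\<lambda>n. - real n) at_infinity sequentially"
      using filterlim_real_sequentially
      by (intro filterlim_at_bot_imp_at_infinity) (simp add: filterlim_uminus_at_bot)
    ultimately show "(\<lambda>n. B (real n) * t + B (- real n) * t) \<longlonglongrightarrow> 0"
      by (intro tendsto_add_zero tendsto_mult_left_zero filterlim_compose[OF lim_B])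
  qed
  moreover have "(\<lambda>n. J t n - J 0 n) \<longlonglongrightarrow> (\<integral>l. H (of_real t + \<i> * of_real l) \<partial>lborel)
      - (\<integral>l. H (of_real 0 + \<i> * of_real l) \<partial>lborel)"
    by (intro tendsto_diff lim_J) (use t in auto)
  ultimately show ?thesis
    by (auto dest: LIMSEQ_unique)
qed

lemma integrable_indicator_Icc: "integrable lborel (indicator {a..b::real} :: real \<Rightarrow> real)"
  by (rule integrable_real_indicator) (simp_all add: emeasure_lborel_Icc_eq)

lemma (in pair_sigma_finite) integrable_dominated_by_product:
  fixes f :: "'a \<Rightarrow> real" and g :: "'b \<Rightarrow> real" and F :: "'a \<times> 'b \<Rightarrow> 'c::{banach, second_countable_topology}"
  assumes f: "integrable M1 f" and g: "integrable M2 g"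
    and [measurable]: "F \<in> borel_measurable (M1 \<Otimes>\<^sub>M M2)"
    and le: "\<And>x y. x \<in> space M1 \<Longrightarrow> y \<in> space M2 \<Longrightarrow> norm (F (x, y)) \<le> f x * g y"
  shows "integrable (M1 \<Otimes>\<^sub>M M2) F"
proof (rule Bochner_Integration.integrable_bound)
  have [measurable]: "f \<in> borel_measurable M1" "g \<in> borel_measurable M2" using f g by auto
  show "integrable (M1 \<Otimes>\<^sub>M M2) (\<lambda>(x, y). f x * g y)"
  proof (rule Fubini_integrable)
    show "integrable M1 (\<lambda>x. \<integral>y. norm (case (x, y) of (x, y) \<Rightarrow> f x * g y) \<partial>M2)"
      using f by (simp add: abs_mult)
    show "AE x in M1. integrable M2 (\<lambda>y. case (x, y) of (x, y) \<Rightarrow> f x * g y)"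
      using g by simp
  qed measurable
  show "AE z in M1 \<Otimes>\<^sub>M M2. norm (F z) \<le> norm (case z of (x, y) \<Rightarrow> f x * g y)"
    using le by (intro AE_I2) (force simp: space_pair_measure intro: order_trans[OF _ abs_ge_self])
qed measurable

text \<open>The quotient on the right is the kernel of the Levy inversion formula. Written as an
  integral over x it lets Fubini expose the density.\<close>

lemma integral_iexp_Icc:
  fixes a b t :: real
  assumes "a \<le> b" "t \<noteq> 0"
  shows "(\<integral>x. indicator {a..b} x *\<^sub>R iexp (- (t * x)) \<partial>lborel) = (iexp (- (t * a)) - iexp (- (t * b))) / (\<i> * t)"
proof -
  have "has_bochner_integral lborel (\<lambda>x. indicator {a..b} x *\<^sub>R iexp (- (t * x)))
      (iexp (- (t * b)) / (- \<i> * t) - iexp (- (t * a)) / (- \<i> * t))"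
  proof (rule has_bochner_integral_FTC_Icc)
    fix x :: real
    have "((\<lambda>x. exp (- (\<i> * t * x)) / (- \<i> * t)) has_field_derivative exp (- (\<i> * t * of_real x))) (at (of_real x))"
      using assms by (auto intro!: derivative_eq_intros)
    from has_vector_derivative_at_within[OF has_vector_derivative_real_field[OF this]]
    show "((\<lambda>x. iexp (- (t * x)) / (- \<i> * t)) has_vector_derivative iexp (- (t * x))) (at x within {a..b})"
      by (simp add: mult.assoc)
  qed (use assms in \<open>auto intro!: continuous_intros\<close>)
  then show ?thesis using assms by (simp add: has_bochner_integral_iff field_simps)
qed

section \<open>Density of a distribution with integrable characteristic function\<close>

context real_distribution
begin

text \<open>The atoms of a finite measure are countable, so they cannot fill an open
  interval.\<close>

lemma exists_continuity_point:
  fixes a b :: real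
  assumes "a < b"
  obtains c where "a < c" "c < b" "measure M {c} = 0"
proof -
  have "{a<..<b} - {x. measure M {x} \<noteq> 0} \<noteq> {}"
    using open_minus_countable[OF countable_support, of "{a<..<b}"] assms by auto
  then show thesis using that by auto
qed

text \<open>Kept complex so that it is a plain integral of the characteristic function; its real
  part serves as the density.\<close>

definition fourier_density :: "real \<Rightarrow> complex" where
  "fourier_density x = (\<integral>t. iexp (- (t * x)) * char M t \<partial>lborel) / (2 * pi)"

context
  assumes int_char: "integrable lborel (char M)"
begin

lemma char_measurable [measurable]: "char M \<in> borel_measurable borel"
  using int_char by (auto dest: borel_measurable_integrable)

lemma continuous_fourier_density: "continuous_on UNIV fourier_density"
proof (rule continuous_on_sequentiallyI)
  fix u :: "nat \<Rightarrow> real" and x assume lim: "u \<longlonglongrightarrow> x"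
  have "(\<lambda>n. \<integral>t. iexp (- (t * u n)) * char M t \<partial>lborel) \<longlonglongrightarrow> (\<integral>t. iexp (- (t * x)) * char M t \<partial>lborel)"
  proof (rule integral_dominated_convergence[where w="\<lambda>t. norm (char M t)"])
    show "AE t in lborel. (\<lambda>n. iexp (- (t * u n)) * char M t) \<longlonglongrightarrow> iexp (- (t * x)) * char M t"
      by (intro AE_I2 tendsto_intros lim)
  qed (use int_char in \<open>auto simp: norm_mult\<close>)
  then show "(\<lambda>n. fourier_density (u n)) \<longlonglongrightarrow> fourier_density x"
    unfolding fourier_density_def by (intro tendsto_intros) auto
qed

lemma measurable_fourier_density [measurable]: "fourier_density \<in> borel_measurable borel"
  using continuous_fourier_density by (rule borel_measurable_continuous_onI)

lemma norm_fourier_density_le: "norm (fourier_density x) \<le> (\<integral>t. norm (char M t) \<partial>lborel)"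
proof -
  have "norm (fourier_density x) = norm (\<integral>t. iexp (- (t * x)) * char M t \<partial>lborel) / (2 * pi)"
    by (simp add: fourier_density_def norm_divide)
  also have "\<dots> \<le> norm (\<integral>t. iexp (- (t * x)) * char M t \<partial>lborel) / 1"
    using pi_gt3 by (intro divide_left_mono) auto
  also have "\<dots> = norm (\<integral>t. iexp (- (t * x)) * char M t \<partial>lborel)"
    by simp
  also have "\<dots> \<le> (\<integral>t. norm (iexp (- (t * x)) * char M t) \<partial>lborel)"
    by (rule integral_norm_bound)
  finally show ?thesis by (simp add: norm_mult)
qed

text \<open>Levy inversion excludes atoms at the endpoints. Its kernel is bounded by b - a, so with
  an integrable characteristic function the limit over [-n, n] becomes a Lebesgue integral, and
  Fubini applies.\<close>

lemma measure_Ioc_eq_integral_if_null_endpoints: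
  assumes "a \<le> b" "measure M {a} = 0" "measure M {b} = 0"
  shows "of_real (measure M {a<..b}) = (\<integral>x. indicator {a..b} x *\<^sub>R fourier_density x \<partial>lborel)"
proof -
  let ?F = "\<lambda>t. (iexp (- (t * a)) - iexp (- (t * b))) / (\<i> * t) * char M t"
  have F_le: "norm (?F t) \<le> (b - a) * norm (char M t)" if "t \<noteq> 0" for t
    using Levy_Inversion_aux2[of "- b" "- a" t] assms that
    unfolding norm_mult by (intro mult_right_mono) auto
  \<comment> \<open>At t = 0 the quotient in \<open>?F\<close> has the default value 0, while the
    integral over x equals b - a; the two sides agree off this null set only.\<close>
  have AE_nz: "AE t in lborel. t \<noteq> (0::real)" by (rule AE_lborel_singleton)
  have "(\<lambda>n. (CLBINT t=-real n..real n. ?F t)) \<longlonglongrightarrow> (\<integral>t. ?F t \<partial>lborel)"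
  proof -
    have "(CLBINT t=-real n..real n. ?F t) = (\<integral>t. indicator {- real n<..<real n} t *\<^sub>R ?F t \<partial>lborel)" for n
      by (simp add: interval_lebesgue_integral_def set_lebesgue_integral_def)
    moreover have "(\<lambda>n. \<integral>t. indicator {- real n<..<real n} t *\<^sub>R ?F t \<partial>lborel) \<longlonglongrightarrow> (\<integral>t. ?F t \<partial>lborel)"
    proof (rule integral_dominated_convergence[where w="\<lambda>t. (b - a) * norm (char M t)"])
      show "AE t in lborel. (\<lambda>n. indicator {- real n<..<real n} t *\<^sub>R ?F t) \<longlonglongrightarrow> ?F t"
      proof (rule AE_I2, rule tendsto_eventually)
        fix t :: real
        show "\<forall>\<^sub>F n in sequentially. indicator {- real n<..<real n} t *\<^sub>R ?F t = ?F t"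
          using eventually_gt_at_top[of "nat \<lceil>\<bar>t\<bar>\<rceil>"]
        proof eventually_elim
          case (elim n)
          then have "t \<in> {- real n<..<real n}" unfolding greaterThanLessThan_iff by linarith
          then show ?case by simp
        qed
      qed
      show "AE t in lborel. norm (indicator {- real n<..<real n} t *\<^sub>R ?F t) \<le> (b - a) * norm (char M t)" for n
        using AE_nz
      proof eventually_elim
        case (elim t)
        have "norm (indicator {- real n<..<real n} t *\<^sub>R ?F t) \<le> norm (?F t)"
          by (simp add: indicator_def)
        also note F_le[OF elim]
        finally show ?case .
      qed
    qed (use int_char in auto)
    ultimately show ?thesis by simp
  qed
  then have "(\<lambda>n. 1 / (2 * pi) * (CLBINT t=-real n..real n. ?F t)) \<longlonglongrightarrow> 1 / (2 * pi) * (\<integral>t. ?F t \<partial>lborel)"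
    by (intro tendsto_intros)
  with Levy_Inversion[OF assms, unfolded of_int_minus of_int_of_nat_eq] have "of_real (measure M {a<..b}) = 1 / (2 * pi) * (\<integral>t. ?F t \<partial>lborel)"
    by (rule LIMSEQ_unique)
  also have "(\<integral>t. ?F t \<partial>lborel)
      = (\<integral>t. (\<integral>x. indicator {a..b} x *\<^sub>R (iexp (- (t * x)) * char M t) \<partial>lborel) \<partial>lborel)"
  proof (rule integral_cong_AE)
    show "AE t in lborel. ?F t = (\<integral>x. indicator {a..b} x *\<^sub>R (iexp (- (t * x)) * char M t) \<partial>lborel)"
      using AE_nz
    proof eventually_elim
      case (elim t)
      then show ?case
        by (subst integral_iexp_Icc[OF assms(1) elim, symmetric])
           (simp flip: integral_mult_left_zero)
    qed
  qed measurable
  also have "\<dots> = (\<integral>x. (\<integral>t. indicator {a..b} x *\<^sub>R (iexp (- (t * x)) * char M t) \<partial>lborel) \<partial>lborel)"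
  proof (rule lborel_pair.Fubini_integral)
    show "integrable (lborel \<Otimes>\<^sub>M lborel) (\<lambda>(x, t). indicator {a..b} x *\<^sub>R (iexp (- (t * x)) * char M t))"
    proof (rule lborel_pair.integrable_dominated_by_product)
      show "integrable lborel (indicat_real {a..b})" by (rule integrable_indicator_Icc)
      show "integrable lborel (\<lambda>t. norm (char M t))" using int_char by simp
    qed (auto simp: norm_mult)
  qed
  also have "1 / (2 * pi) * \<dots> = (\<integral>x. indicator {a..b} x *\<^sub>R fourier_density x \<partial>lborel)"
    unfolding fourier_density_def by (simp flip: integral_mult_right_zero)
  finally show ?thesis .
qed

lemma measure_Ioc_le:
  assumes "a \<le> b" "measure M {a} = 0" "measure M {b} = 0"
  shows "measure M {a<..b} \<le> (\<integral>t. norm (char M t) \<partial>lborel) * (b - a)"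
proof -
  let ?B = "\<integral>t. norm (char M t) \<partial>lborel"
  have "measure M {a<..b} = norm (complex_of_real (measure M {a<..b}))" by simp
  also have "\<dots> \<le> (\<integral>x. norm (indicator {a..b} x *\<^sub>R fourier_density x) \<partial>lborel)"
    unfolding measure_Ioc_eq_integral_if_null_endpoints[OF assms] by (rule integral_norm_bound)
  also have "\<dots> \<le> (\<integral>x. ?B * indicator {a..b} x \<partial>lborel)"
  proof (rule integral_mono)
    show *: "integrable lborel (\<lambda>x. ?B * indicator {a..b} x)" by (intro integrable_mult_right integrable_indicator_Icc)
    from * show "integrable lborel (\<lambda>x. norm (indicator {a..b} x *\<^sub>R fourier_density x))"
      by (rule Bochner_Integration.integrable_bound)
         (use norm_fourier_density_le in \<open>auto simp: indicator_def\<close>)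
  qed (use norm_fourier_density_le in \<open>auto simp: indicator_def\<close>)
  also have "\<dots> = ?B * (b - a)" using assms by simp
  finally show ?thesis .
qed

text \<open>The point is squeezed between two non-atoms at distance less than e, where the density
  formula already holds and bounds the mass by a multiple of e. This frees the interval formula from
  its condition on the endpoints.\<close>

lemma measure_singleton_0: "measure M {c} = 0"
proof -
  let ?B = "\<integral>t. norm (char M t) \<partial>lborel"
  have bound: "measure M {c} \<le> ?B * (2 * e)" if e: "0 < e" for e
  proof -
    obtain a where a: "c - e < a" "a < c" "measure M {a} = 0"
      by (rule exists_continuity_point[of "c - e" c]) (use e in auto)
    obtain b where b: "c < b" "b < c + e" "measure M {b} = 0"
      by (rule exists_continuity_point[of c "c + e"]) (use e in auto)
    have "measure M {c} \<le> measure M {a<..b}"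
      using a b by (intro finite_measure_mono) auto
    also have "\<dots> \<le> ?B * (b - a)" using a b by (intro measure_Ioc_le) auto
    also have "\<dots> \<le> ?B * (2 * e)" using a b by (intro mult_left_mono) auto
    finally show ?thesis .
  qed
  have "((\<lambda>e. ?B * (2 * e)) \<longlongrightarrow> ?B * (2 * 0)) (at_right 0)"
    by (intro tendsto_intros)
  moreover have "\<forall>\<^sub>F e in at_right 0. measure M {c} \<le> ?B * (2 * e)"
    using eventually_at_right_less[of "0::real"] by eventually_elim (rule bound)
  ultimately have "measure M {c} \<le> ?B * (2 * 0)"
    by (intro tendsto_lowerbound[where F="at_right 0"]) auto
  then show ?thesis using measure_nonneg[of M "{c}"] by simp
qed

lemma fourier_density_integrable_Icc:
  "integrable lborel (\<lambda>x. indicator {a..b} x *\<^sub>R fourier_density x)"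
proof -
  have "continuous_on {a..b} fourier_density"
    using continuous_fourier_density continuous_on_subset by blast
  then show ?thesis using borel_integrable_atLeastAtMost'[of a b fourier_density] by (simp add: set_integrable_def)
qed

lemma measure_Ioc_eq_integral:
  assumes "a \<le> b"
  shows "measure M {a<..b} = (\<integral>x. indicator {a..b} x * Re (fourier_density x) \<partial>lborel)"
proof -
  have "measure M {a<..b} = Re (\<integral>x. indicator {a..b} x *\<^sub>R fourier_density x \<partial>lborel)"
    unfolding measure_Ioc_eq_integral_if_null_endpoints[OF assms measure_singleton_0 measure_singleton_0, symmetric] by simp
  also have "\<dots> = (\<integral>x. Re (indicator {a..b} x *\<^sub>R fourier_density x) \<partial>lborel)"
    by (rule integral_Re[symmetric]) (rule fourier_density_integrable_Icc)
  finally show ?thesis by simp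
qed

text \<open>A negative value would, by continuity, stay below half of itself on a short interval,
  which would then have negative measure. Continuity gives the sign at every point, not just almost
  everywhere.\<close>

lemma Re_fourier_density_nonneg: "0 \<le> Re (fourier_density x)"
proof (rule ccontr)
  assume neg: "\<not> 0 \<le> Re (fourier_density x)"
  define c where "c = Re (fourier_density x) / 2"
  have c: "c < 0" "Re (fourier_density x) < c" using neg by (auto simp: c_def)
  have "continuous_on UNIV (\<lambda>x. Re (fourier_density x))"
    by (intro continuous_intros continuous_fourier_density)
  then have "isCont (\<lambda>x. Re (fourier_density x)) x" by (simp add: continuous_on_eq_continuous_at)
  then have "\<forall>\<^sub>F y in nhds x. Re (fourier_density y) < c"
    using c by (intro order_tendstoD) (auto simp: isCont_def tendsto_nhds_iff)
  then obtain d where d: "0 < d" "\<And>y. dist y x < d \<Longrightarrow> Re (fourier_density y) < c"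
    by (auto simp: eventually_nhds_metric)
  let ?b = "x + d / 2"
  have "measure M {x<..?b} \<le> (\<integral>y. indicator {x..?b} y * c \<partial>lborel)"
  proof -
    have "measure M {x<..?b} = (\<integral>y. indicator {x..?b} y * Re (fourier_density y) \<partial>lborel)"
      using d by (intro measure_Ioc_eq_integral) auto
    also have "\<dots> \<le> (\<integral>y. indicator {x..?b} y * c \<partial>lborel)"
    proof (rule integral_mono)
      show "integrable lborel (\<lambda>y. indicator {x..?b} y * Re (fourier_density y))"
        using integrable_Re[OF fourier_density_integrable_Icc[of x ?b]] by simp
      show "indicator {x..?b} y * Re (fourier_density y) \<le> indicator {x..?b} y * c" for y
        using d(2)[of y] d(1) by (auto simp: indicator_def dist_real_def)
    qed (intro integrable_mult_left integrable_indicator_Icc)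
    finally show ?thesis .
  qed
  also have "\<dots> = d / 2 * c" using d by simp
  also have "\<dots> < 0" using d c by (simp add: mult_less_0_iff)
  finally show False using measure_nonneg[of M "{x<..?b}"] by linarith
qed

lemma eq_density_fourier_density: "M = density lborel (\<lambda>x. ennreal (Re (fourier_density x)))"
proof (rule measure_eqI_generator_eq)
  let ?E = "range (\<lambda>(a, b). {a <.. b::real})"
  show "Int_stable ?E"
  proof (rule Int_stableI)
    fix A B assume "A \<in> ?E" "B \<in> ?E"
    then obtain a b c d where "A = {a<..b}" "B = {c<..d}" by auto
    then have "A \<inter> B = (\<lambda>(a, b). {a<..b}) (max a c, min b d)" by auto
    then show "A \<inter> B \<in> ?E" by blast
  qed
  show "?E \<subseteq> Pow UNIV" by simp
  show "sets M = sigma_sets UNIV ?E" "sets (density lborel (\<lambda>x. ennreal (Re (fourier_density x)))) = sigma_sets UNIV ?E"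
    by (simp_all add: borel_sigma_sets_Ioc)
  show "range (\<lambda>n::nat. {- real n<..real n}) \<subseteq> ?E" by auto
  show "(\<Union>n::nat. {- real n<..real n}) = UNIV"
  proof -
    have "\<exists>n. - real n < x \<and> x \<le> real n" for x
    proof -
      obtain n :: nat where "\<bar>x\<bar> < real n" using reals_Archimedean2 by blast
      then show ?thesis by (intro exI[of _ n]) auto
    qed
    then show ?thesis by auto
  qed
  show "emeasure M {- real n<..real n} \<noteq> \<infinity>" for n by simp
  fix X assume "X \<in> ?E"
  then obtain a b where X: "X = {a<..b}" by auto
  show "emeasure M X = emeasure (density lborel (\<lambda>x. ennreal (Re (fourier_density x)))) X"
  proof (cases "a \<le> b")
    case True
    have int: "integrable lborel (\<lambda>x. indicator {a..b} x * Re (fourier_density x))"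
      using integrable_Re[OF fourier_density_integrable_Icc[of a b]] by simp
    have "emeasure M X = ennreal (\<integral>x. indicator {a..b} x * Re (fourier_density x) \<partial>lborel)"
      by (simp add: X emeasure_eq_measure measure_Ioc_eq_integral[OF True])
    also have "\<dots> = (\<integral>\<^sup>+x. ennreal (indicator {a..b} x * Re (fourier_density x)) \<partial>lborel)"
      using int Re_fourier_density_nonneg by (intro nn_integral_eq_integral[symmetric]) auto
    also have "\<dots> = (\<integral>\<^sup>+x. ennreal (Re (fourier_density x)) * indicator {a<..b} x \<partial>lborel)"
    proof (rule nn_integral_cong_AE)
      show "AE x in lborel. ennreal (indicator {a..b} x * Re (fourier_density x))
          = ennreal (Re (fourier_density x)) * indicator {a<..b} x"
        using AE_lborel_singleton[of a] by eventually_elim (auto simp: indicator_def)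
    qed
    also have "\<dots> = emeasure (density lborel (\<lambda>x. ennreal (Re (fourier_density x)))) X"
      unfolding X by (rule emeasure_density[symmetric]) auto
    finally show ?thesis .
  qed (simp add: X)
qed

end
end

section \<open>Riemann sums\<close>

text \<open>Clamping the argument to the interval turns f into a function monotone on the whole
  line, hence Borel; it is bounded by its two end values.\<close>

lemma set_integrable_mono_Icc:
  fixes f :: "real \<Rightarrow> real"
  assumes mono: "\<And>x y. s \<le> x \<Longrightarrow> x \<le> y \<Longrightarrow> y \<le> t \<Longrightarrow> f x \<le> f y"
  shows "set_integrable lborel {s..t} f"
proof (cases "s \<le> t")
  case True
  have "mono (\<lambda>x. f (max s (min t x)))"
    using True by (intro monoI mono) auto
  then have [measurable]: "(\<lambda>x. f (max s (min t x))) \<in> borel_measurable borel"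
    by (rule borel_measurable_mono)
  have "set_integrable lborel {s..t} (\<lambda>x. f (max s (min t x)))"
    unfolding set_integrable_def
  proof (rule integrableI_bounded_set_indicator[where B="max \<bar>f s\<bar> \<bar>f t\<bar>"])
    show "AE x in lborel. x \<in> {s..t} \<longrightarrow> norm (f (max s (min t x))) \<le> max \<bar>f s\<bar> \<bar>f t\<bar>"
    proof (intro AE_I2 impI)
      fix x assume "x \<in> {s..t}"
      then have "f s \<le> f x" "f x \<le> f t" "max s (min t x) = x" using mono by auto
      then show "norm (f (max s (min t x))) \<le> max \<bar>f s\<bar> \<bar>f t\<bar>" by auto
    qed
  qed (auto simp: emeasure_lborel_Icc_eq)
  moreover have "set_integrable lborel {s..t} (\<lambda>x. f (max s (min t x))) \<longleftrightarrow> set_integrable lborel {s..t} f"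
    by (rule set_integrable_cong) auto
  ultimately show ?thesis by simp
qed (simp add: set_integrable_def)

lemma mono_integral_Icc_bounds:
  fixes f :: "real \<Rightarrow> real"
  assumes "\<And>x y. s \<le> x \<Longrightarrow> x \<le> y \<Longrightarrow> y \<le> s + real n * h \<Longrightarrow> f x \<le> f y" and h: "0 \<le> h"
  shows "(\<Sum>k<n. h * f (s + real k * h)) \<le> integral {s..s + real n * h} f \<and>
    integral {s..s + real n * h} f \<le> (\<Sum>k<n. h * f (s + real (Suc k) * h))"
  using assms(1)
proof (induction n)
  case (Suc n)
  let ?a = "s + real n * h" and ?b = "s + real (Suc n) * h"
  have le: "s \<le> ?a" "?a \<le> ?b" using h by (auto simp: distrib_right)
  have IH: "(\<Sum>k<n. h * f (s + real k * h)) \<le> integral {s..?a} f \<and>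
      integral {s..?a} f \<le> (\<Sum>k<n. h * f (s + real (Suc k) * h))"
    using le by (intro Suc.IH Suc.prems) auto
  have int: "f integrable_on {s..?b}"
    using Suc.prems by (intro set_borel_integral_eq_integral(1) set_integrable_mono_Icc) auto
  have int': "f integrable_on {?a..?b}"
    by (rule integrable_subinterval_real[OF int]) (use le in auto)
  have eq: "integral {s..?b} f = integral {s..?a} f + integral {?a..?b} f"
    using Henstock_Kurzweil_Integration.integral_combine[OF le int] by simp
  have len: "?b - ?a = h" by (simp add: algebra_simps)
  have "integral {?a..?b} (\<lambda>_. f ?a) \<le> integral {?a..?b} f"
    by (rule integral_le) (use int' le Suc.prems in \<open>auto\<close>)
  moreover have "integral {?a..?b} f \<le> integral {?a..?b} (\<lambda>_. f ?b)"
    by (rule integral_le) (use int' le Suc.prems in \<open>auto\<close>)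
  ultimately have "h * f ?a \<le> integral {?a..?b} f" "integral {?a..?b} f \<le> h * f ?b"
    using le len by (simp_all del: of_nat_Suc)
  then show ?case using IH eq by (auto simp del: of_nat_Suc)
qed simp

text \<open>The integral lies between the left and the right sum, whose difference telescopes to
  mesh times f t - f s. Using \<open>Suc n\<close> cells avoids division by zero.\<close>

lemma mono_riemann_sum_tendsto:
  fixes f :: "real \<Rightarrow> real"
  assumes st: "s \<le> t" and mono: "\<And>x y. s \<le> x \<Longrightarrow> x \<le> y \<Longrightarrow> y \<le> t \<Longrightarrow> f x \<le> f y"
  shows "(\<lambda>n. \<Sum>k<Suc n. (t - s) / real (Suc n) * f (s + real k * ((t - s) / real (Suc n))))
    \<longlonglongrightarrow> (\<integral>x\<in>{s..t}. f x \<partial>lborel)"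
proof -
  let ?I = "\<integral>x\<in>{s..t}. f x \<partial>lborel"
  let ?R = "\<lambda>n. \<Sum>k<Suc n. (t - s) / real (Suc n) * f (s + real k * ((t - s) / real (Suc n)))"
  have I: "?I = integral {s..t} f"
    using mono by (intro set_borel_integral_eq_integral(2) set_integrable_mono_Icc) auto
  have bound: "norm (?R n - ?I) \<le> (t - s) * (f t - f s) / real (Suc n)" for n
  proof -
    let ?h = "(t - s) / real (Suc n)"
    have end_eq: "s + real (Suc n) * ?h = t" by simp
    have b: "?R n \<le> ?I \<and> ?I \<le> (\<Sum>k<Suc n. ?h * f (s + real (Suc k) * ?h))"
      using mono_integral_Icc_bounds[of s "Suc n" ?h f] mono st unfolding end_eq I
      by auto
    have "(\<Sum>k<Suc n. ?h * f (s + real (Suc k) * ?h)) - ?R n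
        = ?h * (\<Sum>k<Suc n. f (s + real (Suc k) * ?h) - f (s + real k * ?h))"
      unfolding sum_distrib_left sum_subtractf[symmetric] by (intro sum.cong) (auto simp: right_diff_distrib)
    also have "\<dots> = ?h * (f (s + real (Suc n) * ?h) - f (s + real 0 * ?h))"
      by (subst sum_lessThan_telescope) simp
    also have "\<dots> = (t - s) * (f t - f s) / real (Suc n)" unfolding end_eq by simp
    finally show ?thesis using b by auto
  qed
  have lim: "(\<lambda>n. (t - s) * (f t - f s) / real (Suc n)) \<longlonglongrightarrow> 0"
    by (rule LIMSEQ_Suc[OF lim_const_over_n])
  have "(\<lambda>n. ?R n - ?I) \<longlonglongrightarrow> 0"
    by (rule Lim_null_comparison[OF always_eventually[OF allI[OF bound]] lim])
  then show ?thesis by (simp add: LIM_zero_iff)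
qed

text \<open>Two applications of the mean value inequality: with C bounding the derivative of g on
  the segment, g varies by at most C h over a cell of length h, so G deviates from its linear
  approximation by at most C h^2. The n + 1 cells add up to C \<tau>^2 / (n + 1).\<close>

lemma holomorphic_riemann_sum_tendsto:
  fixes G g :: "complex \<Rightarrow> complex"
  assumes G: "\<And>z. (G has_field_derivative g z) (at z)" and hol: "g holomorphic_on UNIV" and \<tau>: "0 \<le> \<tau>"
  shows "(\<lambda>n. \<Sum>k<Suc n. of_real (\<tau> / real (Suc n)) * g (z + of_real (real k * (\<tau> / real (Suc n)))))
    \<longlonglongrightarrow> G (z + of_real \<tau>) - G z"
proof -
  let ?K = "closed_segment z (z + of_real \<tau>)"
  have "continuous_on ?K (deriv g)"
    using hol by (intro holomorphic_on_imp_continuous_on holomorphic_on_subset[OF holomorphic_deriv]) auto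
  then have "bounded (deriv g ` ?K)"
    by (intro compact_imp_bounded compact_continuous_image) auto
  then obtain C where C: "\<And>w. w \<in> ?K \<Longrightarrow> norm (deriv g w) \<le> C" "0 < C"
    unfolding bounded_pos by auto
  have deriv_g: "(g has_field_derivative deriv g w) (at w within A)" for w A
    using hol holomorphic_derivI[of g UNIV w] by (auto intro: has_field_derivative_at_within)
  have in_K: "z + of_real v \<in> ?K" if "0 \<le> v" "v \<le> \<tau>" for v
  proof (cases "\<tau> = 0")
    case False
    then show ?thesis using that \<tau>
      unfolding in_segment by (intro exI[of _ "v / \<tau>"]) (auto simp: scaleR_conv_of_real field_simps)
  qed (use that in auto)
  have seg: "closed_segment (z + of_real u) (z + of_real v) \<subseteq> ?K" if "0 \<le> u" "u \<le> v" "v \<le> \<tau>" for u v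
    using that by (intro closed_segment_subset in_K) auto
  have step: "norm (G (z + of_real v) - G (z + of_real u) - of_real (v - u) * g (z + of_real u)) \<le> C * (v - u) * (v - u)"
    if uv: "0 \<le> u" "u \<le> v" "v \<le> \<tau>" for u v
  proof -
    let ?c = "z + of_real u" and ?d = "z + of_real v"
    have "norm ((G ?d - ?d * g ?c) - (G ?c - ?c * g ?c)) \<le> C * (v - u) * norm (?d - ?c)"
    \<comment> \<open>Subtracting w g(c) from G(w) leaves a function with derivative g(w) - g(c),
      which is small on the cell.\<close>
    proof (rule field_differentiable_bound[where f'="\<lambda>w. g w - g ?c" and S="closed_segment ?c ?d" and f="\<lambda>w. G w - w * g ?c"])
      fix w assume w: "w \<in> closed_segment ?c ?d"
      show "((\<lambda>w. G w - w * g ?c) has_field_derivative (g w - g ?c)) (at w within closed_segment ?c ?d)"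
        by (auto intro!: derivative_eq_intros has_field_derivative_at_within[OF G])
      have "norm (g w - g ?c) \<le> C * norm (w - ?c)"
        by (rule field_differentiable_bound[where f'="deriv g" and S="closed_segment ?c ?d"])
           (use w deriv_g C seg[OF uv] in auto)
      also have "norm (w - ?c) \<le> norm (?d - ?c)"
        using segment_bound(1)[OF w] by simp
      also have "\<dots> = v - u" using uv by (simp flip: of_real_diff)
      finally show "norm (g w - g ?c) \<le> C * (v - u)" using C(2) by simp
    qed auto
    also have "(G ?d - ?d * g ?c) - (G ?c - ?c * g ?c) = G ?d - G ?c - of_real (v - u) * g ?c"
      by (simp add: algebra_simps)
    also have "norm (?d - ?c) = v - u" using uv by (simp flip: of_real_diff)
    finally show ?thesis .
  qed
  let ?R = "\<lambda>n. \<Sum>k<Suc n. of_real (\<tau> / real (Suc n)) * g (z + of_real (real k * (\<tau> / real (Suc n))))"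
  have bound: "norm (?R n - (G (z + of_real \<tau>) - G z)) \<le> C * \<tau> * \<tau> / real (Suc n)" for n
  proof -
    let ?h = "\<tau> / real (Suc n)"
    let ?G = "\<lambda>k. G (z + of_real (real k * ?h))"
    have "(G (z + of_real \<tau>) - G z) = ?G (Suc n) - ?G 0" by simp
    also have "\<dots> = (\<Sum>k<Suc n. ?G (Suc k) - ?G k)" by (rule sum_lessThan_telescope[symmetric])
    finally have "norm (?R n - (G (z + of_real \<tau>) - G z))
        = norm (\<Sum>k<Suc n. ?G (Suc k) - ?G k - of_real ?h * g (z + of_real (real k * ?h)))"
      by (simp only: sum_subtractf norm_minus_commute)
    also have "\<dots> \<le> (\<Sum>k<Suc n. C * ?h * ?h)"
    proof (rule sum_norm_le)
      fix k assume "k \<in> {..<Suc n}"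
      then have "real (Suc k) * \<tau> \<le> real (Suc n) * \<tau>" using \<tau> by (intro mult_right_mono) auto
      then have "real (Suc k) * ?h \<le> \<tau>" by (simp add: field_simps)
      moreover have "real (Suc k) * ?h - real k * ?h = ?h" by (simp add: algebra_simps add_divide_distrib)
      ultimately show "norm (?G (Suc k) - ?G k - of_real ?h * g (z + of_real (real k * ?h))) \<le> C * ?h * ?h"
        using step[of "real k * ?h" "real (Suc k) * ?h"] \<tau> by (simp del: of_nat_Suc add: mult_right_mono divide_right_mono)
    qed
    also have "\<dots> = C * \<tau> * \<tau> / real (Suc n)"
      by (simp add: field_simps del: of_nat_Suc)
    finally show ?thesis .
  qed
  have lim: "(\<lambda>n. C * \<tau> * \<tau> / real (Suc n)) \<longlonglongrightarrow> 0"
    by (rule LIMSEQ_Suc[OF lim_const_over_n])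
  have "(\<lambda>n. ?R n - (G (z + of_real \<tau>) - G z)) \<longlonglongrightarrow> 0"
    by (rule Lim_null_comparison[OF always_eventually[OF allI[OF bound]] lim])
  then show ?thesis by (simp add: LIM_zero_iff)
qed

text \<open>Summation by parts: increment j occurs in f k - f 0 for exactly the k with j < k < n. It
  rewrites a Riemann sum of the subordinator as a combination of independent increments.\<close>

lemma sum_diff_first_eq_weighted_increments:
  fixes f :: "nat \<Rightarrow> 'a::comm_ring_1"
  shows "(\<Sum>k<n. f k - f 0) = (\<Sum>j<n. of_nat (n - Suc j) * (f (Suc j) - f j))"
proof (induction n)
  case (Suc n)
  have "(\<Sum>j<Suc n. of_nat (Suc n - Suc j) * (f (Suc j) - f j)) = (\<Sum>j<n. of_nat (n - j) * (f (Suc j) - f j))"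
    by simp
  also have "\<dots> = (\<Sum>j<n. of_nat (n - Suc j) * (f (Suc j) - f j) + (f (Suc j) - f j))"
  proof (rule sum.cong)
    fix j assume "j \<in> {..<n}"
    then have "n - j = Suc (n - Suc j)" by auto
    then show "of_nat (n - j) * (f (Suc j) - f j) = of_nat (n - Suc j) * (f (Suc j) - f j) + (f (Suc j) - f j)"
      by (simp add: algebra_simps)
  qed simp
  also have "\<dots> = (\<Sum>k<n. f k - f 0) + (f n - f 0)"
    by (simp add: sum.distrib sum_lessThan_telescope Suc.IH)
  finally show ?case by simp
qed simp

section \<open>Independence of the increments from the past\<close>

locale levy_subordinator = prob_space N for N :: "'v measure" +
  fixes S :: "real \<Rightarrow> 'v \<Rightarrow> real"
  assumes subordinator: "subordinator N S"
begin

lemma S_measurable: "0 \<le> t \<Longrightarrow> S t \<in> borel_measurable N"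
  using subordinator by (auto simp: subordinator_def levy_process_def)

lemma S_0: "\<omega> \<in> space N \<Longrightarrow> S 0 \<omega> = 0"
  using subordinator by (auto simp: subordinator_def levy_process_def)

lemma S_mono: "\<omega> \<in> space N \<Longrightarrow> 0 \<le> s \<Longrightarrow> s \<le> t \<Longrightarrow> S s \<omega> \<le> S t \<omega>"
  using subordinator by (auto simp: subordinator_def)

lemma S_nonneg: "\<omega> \<in> space N \<Longrightarrow> 0 \<le> t \<Longrightarrow> 0 \<le> S t \<omega>"
  using S_mono[of \<omega> 0 t] by (simp add: S_0)

lemma S_indep_increments:
  assumes "0 \<le> ts 0" "\<And>i. i < n \<Longrightarrow> ts i \<le> ts (Suc i)"
  shows "indep_vars (\<lambda>_. borel) (\<lambda>i \<omega>. S (ts (Suc i)) \<omega> - S (ts i) \<omega>) {..<n}"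
  using subordinator assms by (auto simp: subordinator_def levy_process_def)

lemma S_stationary:
  "0 \<le> s \<Longrightarrow> 0 \<le> t \<Longrightarrow> distr N borel (\<lambda>\<omega>. S (s + t) \<omega> - S s \<omega>) = distr N borel (S t)"
  using subordinator by (auto simp: subordinator_def levy_process_def)

abbreviation past :: "real \<Rightarrow> 'v measure" where
  "past \<equiv> nat_filtration N S"

lemma space_past [simp]: "space (past u) = space N"
  by (auto simp: nat_filtration_def intro!: space_measure_of)

lemma sets_past:
  "sets (past u) = sigma_sets (space N) {S s -` A \<inter> space N | s A. 0 \<le> s \<and> s \<le> u \<and> A \<in> sets borel}"
  by (auto simp: nat_filtration_def intro!: sets_measure_of)

lemma S_past_measurable: "0 \<le> s \<Longrightarrow> s \<le> u \<Longrightarrow> S s \<in> borel_measurable (past u)"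
  by (rule measurableI) (auto simp: sets_past)

lemma past_mono: "u \<le> v \<Longrightarrow> sets (past u) \<subseteq> sets (past v)"
  unfolding sets_past by (rule sigma_sets_mono') (force intro: order_trans)

lemma past_subset_events: "sets (past u) \<subseteq> events"
  unfolding sets_past by (rule sets.sigma_sets_subset) (auto intro: measurable_sets[OF S_measurable])

lemma past_measurable_mono: "u \<le> v \<Longrightarrow> W \<in> measurable (past u) M' \<Longrightarrow> W \<in> measurable (past v) M'"
  using past_mono[of u v] by (auto simp: measurable_def)

lemma past_measurable_N: "W \<in> measurable (past u) M' \<Longrightarrow> W \<in> measurable N M'"
  using past_subset_events[of u] by (auto simp: measurable_def)

text \<open>Independence of increments is given only along finite grids. The times of J, together
  with 0 and u, are sorted and v is appended: the values at J are functions of the increments before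
  u, and the last increment is the one from u to v.\<close>

lemma increment_indep_cylinder:
  assumes uv: "0 \<le> u" "u \<le> v" and J: "finite J" "J \<subseteq> {0..u}"
    and A: "\<And>j. j \<in> J \<Longrightarrow> A j \<in> sets borel" and C: "C \<in> sets borel"
  shows "prob ({\<omega>\<in>space N. \<forall>j\<in>J. S j \<omega> \<in> A j} \<inter> ((\<lambda>\<omega>. S v \<omega> - S u \<omega>) -` C \<inter> space N))
    = prob {\<omega>\<in>space N. \<forall>j\<in>J. S j \<omega> \<in> A j} * prob ((\<lambda>\<omega>. S v \<omega> - S u \<omega>) -` C \<inter> space N)"
proof -
  \<comment> \<open>The point 0 makes partial sums of increments equal to values of S, since S
    starts at 0; the point u makes the last increment start exactly at u.\<close>
  define K where "K = insert 0 (insert u J)"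
  define l where "l = sorted_list_of_set K"
  define n where "n = length l - 1"
  \<comment> \<open>Indices up to n run through the sorted list; of the default value v, only the
    one at index n + 1 matters.\<close>
  define ts where "ts i = (if i \<le> n then l ! i else v)" for i
  define D where "D i \<omega> = S (ts (Suc i)) \<omega> - S (ts i) \<omega>" for i \<omega>
  have K: "finite K" "K \<subseteq> {0..u}" "0 \<in> K" "u \<in> K" using J uv by (auto simp: K_def)
  have l: "set l = K" "sorted l" "distinct l" using K by (auto simp: l_def)
  have len: "length l = Suc n" using K l by (cases l) (auto simp: n_def)
  have in_K: "l ! i \<in> K" if "i \<le> n" for i using l len that by (metis nth_mem less_Suc_eq_le)
  have sorted: "l ! i \<le> l ! j" if "i \<le> j" "j \<le> n" for i j
    using l len that by (intro sorted_nth_mono) auto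
  have idx: "\<exists>i\<le>n. x = l ! i" if "x \<in> K" for x
    using that len unfolding l(1)[symmetric] in_set_conv_nth by (auto simp: less_Suc_eq_le)
  have ts_0: "ts 0 = 0"
  proof -
    obtain i where i: "i \<le> n" "0 = l ! i" using idx[OF K(3)] by auto
    have "l ! 0 \<le> 0" using sorted[of 0 i] i by auto
    moreover have "0 \<le> l ! 0" using in_K[of 0] K(2) by auto
    ultimately show ?thesis by (simp add: ts_def)
  qed
  have ts_n: "ts n = u"
  proof -
    obtain i where i: "i \<le> n" "u = l ! i" using idx[OF K(4)] by auto
    have "u \<le> l ! n" using sorted[of i n] i by auto
    moreover have "l ! n \<le> u" using in_K[of n] K(2) by auto
    ultimately show ?thesis by (simp add: ts_def)
  qed
  have ts_Suc: "ts i \<le> ts (Suc i)" if "i < Suc n" for i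
  proof (cases "i = n")
    case True
    then show ?thesis using ts_n uv by (simp add: ts_def)
  next
    case False
    then show ?thesis using that sorted[of i "Suc i"] by (auto simp: ts_def)
  qed
  have "indep_vars (\<lambda>_. borel) D {..<Suc n}"
    unfolding D_def by (rule S_indep_increments) (auto simp: ts_0 ts_Suc)
  then have "indep_var (PiM {..<n} (\<lambda>_. borel)) (\<lambda>\<omega>. restrict (\<lambda>i. D i \<omega>) {..<n})
      (PiM {n} (\<lambda>_. borel)) (\<lambda>\<omega>. restrict (\<lambda>i. D i \<omega>) {n})"
    by (rule indep_var_restrict) auto
  let ?Y = "\<lambda>\<omega>. restrict (\<lambda>i. D i \<omega>) {..<n}" and ?Z = "\<lambda>\<omega>. restrict (\<lambda>i. D i \<omega>) {n}"
  \<comment> \<open>The cylinder event expressed on the vector of increments: the value at the k-th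
    grid point is the sum of the first k coordinates.\<close>
  define P where "P = {y \<in> space (PiM {..<n} (\<lambda>_. borel)). \<forall>k\<in>{k. k \<le> n \<and> l ! k \<in> J}. (\<Sum>i<k. y i) \<in> A (l ! k)}"
  define Q where "Q = {y \<in> space (PiM {n} (\<lambda>_. borel)). y n \<in> C}"
  have P: "P \<in> sets (PiM {..<n} (\<lambda>_. borel :: real measure))"
    unfolding P_def
  proof (intro sets.sets_Collect_finite_All)
    fix k assume k: "k \<in> {k. k \<le> n \<and> l ! k \<in> J}"
    have "(\<lambda>y. \<Sum>i<k. y i) \<in> borel_measurable (PiM {..<n} (\<lambda>_. borel :: real measure))"
      using k by (intro borel_measurable_sum measurable_component_singleton) auto
    from measurable_sets[OF this A[of "l ! k"]] k
    show "{y \<in> space (PiM {..<n} (\<lambda>_. borel)). (\<Sum>i<k. y i) \<in> A (l ! k)} \<in> sets (PiM {..<n} (\<lambda>_. borel :: real measure))"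
      by (simp add: vimage_def Int_def conj_commute)
  qed simp
  have Q: "Q \<in> sets (PiM {n} (\<lambda>_. borel :: real measure))"
  proof -
    have "(\<lambda>y. y n) \<in> borel_measurable (PiM {n} (\<lambda>_. borel :: real measure))"
      by (intro measurable_component_singleton) auto
    from measurable_sets[OF this C] show ?thesis
      by (simp add: Q_def vimage_def Int_def conj_commute)
  qed
  have tele: "(\<Sum>i<k. D i \<omega>) = S (l ! k) \<omega>" if "k \<le> n" "\<omega> \<in> space N" for k \<omega>
  proof -
    have "(\<Sum>i<k. D i \<omega>) = S (ts k) \<omega> - S (ts 0) \<omega>"
      unfolding D_def by (rule sum_lessThan_telescope)
    moreover have "ts k = l ! k" using that by (simp add: ts_def)
    ultimately show ?thesis using that by (simp add: ts_0 S_0)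
  qed
  have P_eq: "?Y -` P \<inter> space N = {\<omega>\<in>space N. \<forall>j\<in>J. S j \<omega> \<in> A j}"
  proof -
    have "?Y \<omega> \<in> P \<longleftrightarrow> (\<forall>j\<in>J. S j \<omega> \<in> A j)" if \<omega>: "\<omega> \<in> space N" for \<omega>
    proof -
      have sum_eq: "(\<Sum>i<k. ?Y \<omega> i) = S (l ! k) \<omega>" if "k \<le> n" for k
      proof -
        have "(\<Sum>i<k. ?Y \<omega> i) = (\<Sum>i<k. D i \<omega>)" using that by (intro sum.cong) auto
        then show ?thesis using tele[OF that \<omega>] by simp
      qed
      have "?Y \<omega> \<in> P \<longleftrightarrow> (\<forall>k\<in>{k. k \<le> n \<and> l ! k \<in> J}. S (l ! k) \<omega> \<in> A (l ! k))"
        unfolding P_def using sum_eq by (auto simp: space_PiM)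
      also have "\<dots> \<longleftrightarrow> (\<forall>j\<in>J. S j \<omega> \<in> A j)"
        using idx by (auto simp: K_def)
      finally show ?thesis .
    qed
    then show ?thesis by auto
  qed
  have "D n \<omega> = S v \<omega> - S u \<omega>" for \<omega> using ts_n by (simp add: D_def ts_def)
  then have Q_eq: "?Z -` Q \<inter> space N = (\<lambda>\<omega>. S v \<omega> - S u \<omega>) -` C \<inter> space N"
    by (auto simp: Q_def space_PiM)
  have "prob ((\<lambda>\<omega>. (?Y \<omega>, ?Z \<omega>)) -` (P \<times> Q) \<inter> space N) = prob (?Y -` P \<inter> space N) * prob (?Z -` Q \<inter> space N)"
    by (rule indep_varD) fact+
  also have "(\<lambda>\<omega>. (?Y \<omega>, ?Z \<omega>)) -` (P \<times> Q) \<inter> space N = (?Y -` P \<inter> space N) \<inter> (?Z -` Q \<inter> space N)"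
    by auto
  finally show ?thesis unfolding P_eq Q_eq .
qed

text \<open>Finite-dimensional cylinders are stable under intersection and generate the past, so
  their independence from the increment extends to the generated sigma-algebra.\<close>

lemma increment_indep_past:
  assumes uv: "0 \<le> u" "u \<le> v"
  shows "indep_set (sets (past u))
    (sigma_sets (space N) {(\<lambda>\<omega>. S v \<omega> - S u \<omega>) -` C \<inter> space N | C. C \<in> sets borel})"
proof -
  define E where "E = {{\<omega>\<in>space N. \<forall>j\<in>J. S j \<omega> \<in> A j} | J A.
    finite J \<and> J \<subseteq> {0..u} \<and> (\<forall>j\<in>J. A j \<in> sets borel)}"
  let ?F = "{(\<lambda>\<omega>. S v \<omega> - S u \<omega>) -` C \<inter> space N | C. C \<in> sets borel}"
  have cyl: "{\<omega>\<in>space N. \<forall>j\<in>J. S j \<omega> \<in> A j} \<in> sets (past u)"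
    if "finite J" "J \<subseteq> {0..u}" "\<And>j. j \<in> J \<Longrightarrow> A j \<in> sets borel" for J A
  proof -
    have "{\<omega>\<in>space (past u). \<forall>j\<in>J. S j \<omega> \<in> A j} \<in> sets (past u)"
    proof (intro sets.sets_Collect_finite_All)
      fix j assume j: "j \<in> J"
      then have "S j \<in> borel_measurable (past u)" using that(2) by (intro S_past_measurable) auto
      from measurable_sets[OF this that(3)[OF j]]
      show "{\<omega>\<in>space (past u). S j \<omega> \<in> A j} \<in> sets (past u)"
        by (simp add: vimage_def Int_def conj_commute)
    qed (rule that)
    then show ?thesis by simp
  qed
  have E_sub: "E \<subseteq> sets (past u)" using cyl unfolding E_def by blast
  have "indep_set (sigma_sets (space N) E) (sigma_sets (space N) ?F)"
  proof (rule indep_set_sigma_sets)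
    show "indep_set E ?F"
      unfolding indep_sets2_eq
    proof (intro conjI ballI)
      show "E \<subseteq> events" using E_sub past_subset_events by blast
      have "(\<lambda>\<omega>. S v \<omega> - S u \<omega>) \<in> borel_measurable N"
        using uv by (intro borel_measurable_diff S_measurable) auto
      then show "?F \<subseteq> events" by (auto intro: measurable_sets)
      fix a b assume "a \<in> E" "b \<in> ?F"
      then show "prob (a \<inter> b) = prob a * prob b"
        unfolding E_def using increment_indep_cylinder[OF uv] by blast
    qed
    show "Int_stable E"
    proof (rule Int_stableI)
      fix a b assume "a \<in> E" "b \<in> E"
      then obtain J A J' A' where a: "a = {\<omega>\<in>space N. \<forall>j\<in>J. S j \<omega> \<in> A j}" "finite J" "J \<subseteq> {0..u}" "\<forall>j\<in>J. A j \<in> sets borel"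
        and b: "b = {\<omega>\<in>space N. \<forall>j\<in>J'. S j \<omega> \<in> A' j}" "finite J'" "J' \<subseteq> {0..u}" "\<forall>j\<in>J'. A' j \<in> sets borel"
        unfolding E_def by auto
      \<comment> \<open>Times that occur in only one of the two cylinders get \<open>UNIV\<close> as
        their other constraint.\<close>
      define A'' where "A'' j = (if j \<in> J then A j else UNIV) \<inter> (if j \<in> J' then A' j else UNIV)" for j
      have "a \<inter> b = {\<omega>\<in>space N. \<forall>j\<in>J \<union> J'. S j \<omega> \<in> A'' j}"
        unfolding a(1) b(1) A''_def by auto
      moreover have "\<forall>j\<in>J \<union> J'. A'' j \<in> sets borel"
        using a b unfolding A''_def by auto
      ultimately show "a \<inter> b \<in> E"
        unfolding E_def using a b by (intro CollectI exI[of _ "J \<union> J'"] exI[of _ A'']) simp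
    qed
    show "Int_stable ?F"
    proof (rule Int_stableI)
      fix a b assume "a \<in> ?F" "b \<in> ?F"
      then obtain C C' where "C \<in> sets borel" "C' \<in> sets borel"
        "a = (\<lambda>\<omega>. S v \<omega> - S u \<omega>) -` C \<inter> space N" "b = (\<lambda>\<omega>. S v \<omega> - S u \<omega>) -` C' \<inter> space N" by auto
      then show "a \<inter> b \<in> ?F" by (auto intro!: exI[of _ "C \<inter> C'"])
    qed
  qed
  moreover have "sigma_sets (space N) E = sets (past u)"
  proof
    show "sigma_sets (space N) E \<subseteq> sets (past u)"
      using sets.sigma_sets_subset[OF E_sub] by simp
    show "sets (past u) \<subseteq> sigma_sets (space N) E"
      unfolding sets_past
    proof (rule sigma_sets_mono', rule subsetI)
      fix x assume "x \<in> {S s -` A \<inter> space N | s A. 0 \<le> s \<and> s \<le> u \<and> A \<in> sets borel}"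
      then obtain s A where "x = S s -` A \<inter> space N" "0 \<le> s" "s \<le> u" "A \<in> sets borel" by auto
      then show "x \<in> E" unfolding E_def
        by (intro CollectI exI[of _ "{s}"] exI[of _ "\<lambda>_. A"]) auto
    qed
  qed
  ultimately show ?thesis by simp
qed

end

section \<open>Exponential functionals of a subordinator\<close>

lemma grid_in_Icc:
  fixes s t :: real
  assumes "s \<le> t" "k \<le> Suc n"
  shows "s \<le> s + real k * ((t - s) / real (Suc n))" "s + real k * ((t - s) / real (Suc n)) \<le> t"
proof -
  have "real k * (t - s) \<le> real (Suc n) * (t - s)" using assms by (intro mult_right_mono) auto
  then show "s + real k * ((t - s) / real (Suc n)) \<le> t" by (simp add: field_simps)
  show "s \<le> s + real k * ((t - s) / real (Suc n))" using assms by simp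
qed

lemma (in prob_space) indep_set_subset:
  "indep_set A B \<Longrightarrow> A' \<subseteq> A \<Longrightarrow> B' \<subseteq> B \<Longrightarrow> indep_set A' B'"
  unfolding indep_sets2_eq by blast

context levy_subordinator
begin

lemma integral_S_riemann:
  assumes "0 \<le> s" "s \<le> t" "\<omega> \<in> space N"
  shows "(\<lambda>n. \<Sum>k<Suc n. (t - s) / real (Suc n) * S (s + real k * ((t - s) / real (Suc n))) \<omega>)
    \<longlonglongrightarrow> (\<integral>x\<in>{s..t}. S x \<omega> \<partial>lborel)"
  using assms S_mono by (intro mono_riemann_sum_tendsto) auto

text \<open>Pointwise limit of Riemann sums whose grid points stay in [s, t]; thus measurability for
  the past is obtained without joint measurability in time and \<omega>.\<close>

lemma integral_S_past_measurable:
  assumes "0 \<le> s" "s \<le> t"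
  shows "(\<lambda>\<omega>. \<integral>x\<in>{s..t}. S x \<omega> \<partial>lborel) \<in> borel_measurable (past t)"
proof (rule borel_measurable_LIMSEQ_real)
  show "(\<lambda>n. \<Sum>k<Suc n. (t - s) / real (Suc n) * S (s + real k * ((t - s) / real (Suc n))) \<omega>)
      \<longlonglongrightarrow> (\<integral>x\<in>{s..t}. S x \<omega> \<partial>lborel)" if "\<omega> \<in> space (past t)" for \<omega>
    using integral_S_riemann[OF assms] that by simp
  show "(\<lambda>\<omega>. \<Sum>k<Suc n. (t - s) / real (Suc n) * S (s + real k * ((t - s) / real (Suc n))) \<omega>)
      \<in> borel_measurable (past t)" for n
  proof (intro borel_measurable_sum borel_measurable_times borel_measurable_const S_past_measurable)
    fix k assume "k \<in> {..<Suc n}"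
    then have k: "k \<le> Suc n" by simp
    show "s + real k * ((t - s) / real (Suc n)) \<le> t" by (rule grid_in_Icc[OF assms(2) k])
    show "0 \<le> s + real k * ((t - s) / real (Suc n))" using grid_in_Icc(1)[OF assms(2) k] assms by linarith
  qed
qed

end

text \<open>\<open>g\<close> is the exponent of the unkilled subordinator and \<open>G\<close> a
  primitive of it. The transform is prescribed on the imaginary axis; its validity on the whole
  plane is derived in \<open>exp_S\<close> from \<open>g\<close> being entire.\<close>

locale exp_subordinator = levy_subordinator +
  fixes g G :: "complex \<Rightarrow> complex"
  assumes hol_g: "g holomorphic_on UNIV"
    and G_deriv: "\<And>z. (G has_field_derivative g z) (at z)"
    and S_char: "\<And>t l::real. 0 \<le> t \<Longrightarrow>
      (\<integral>\<omega>. exp (\<i> * of_real l * of_real (S t \<omega>)) \<partial>N) = exp (of_real t * g (\<i> * of_real l))"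
begin

lemma exp_S:
  assumes "0 \<le> t"
  shows "integrable N (\<lambda>\<omega>. exp (z * of_real (S t \<omega>)))"
    and "(\<integral>\<omega>. exp (z * of_real (S t \<omega>)) \<partial>N) = exp (of_real t * g z)"
proof -
  have hol: "(\<lambda>z. exp (of_real t * g z)) holomorphic_on UNIV"
    by (intro holomorphic_intros hol_g)
  note * = laplace_transform_eq_entire[OF S_measurable[OF assms] S_nonneg[OF _ assms] hol S_char[OF assms]]
  show "integrable N (\<lambda>\<omega>. exp (z * of_real (S t \<omega>)))" by (rule *(1))
  show "(\<integral>\<omega>. exp (z * of_real (S t \<omega>)) \<partial>N) = exp (of_real t * g z)" by (rule *(2))
qed

lemma exp_increment:
  assumes uv: "0 \<le> u" "u \<le> v"
  shows "integrable N (\<lambda>\<omega>. exp (z * of_real (S v \<omega> - S u \<omega>)))"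
    and "(\<integral>\<omega>. exp (z * of_real (S v \<omega> - S u \<omega>)) \<partial>N) = exp (of_real (v - u) * g z)"
proof -
  have d: "distr N borel (\<lambda>\<omega>. S v \<omega> - S u \<omega>) = distr N borel (S (v - u))"
    using S_stationary[of u "v - u"] uv by simp
  have [measurable]: "S u \<in> borel_measurable N" "S v \<in> borel_measurable N" "S (v - u) \<in> borel_measurable N"
    using uv by (auto intro: S_measurable)
  have [measurable]: "(\<lambda>x. exp (z * of_real x)) \<in> borel_measurable borel"
    by measurable
  have "integrable (distr N borel (S (v - u))) (\<lambda>x. exp (z * of_real x))"
    using exp_S(1)[of "v - u" z] uv by (subst integrable_distr_eq) auto
  then show "integrable N (\<lambda>\<omega>. exp (z * of_real (S v \<omega> - S u \<omega>)))"
    unfolding d[symmetric] by (subst (asm) integrable_distr_eq) auto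
  have "(\<integral>\<omega>. exp (z * of_real (S v \<omega> - S u \<omega>)) \<partial>N) = (\<integral>x. exp (z * of_real x) \<partial>distr N borel (\<lambda>\<omega>. S v \<omega> - S u \<omega>))"
    by (subst integral_distr) auto
  also have "\<dots> = (\<integral>\<omega>. exp (z * of_real (S (v - u) \<omega>)) \<partial>N)"
    unfolding d by (subst integral_distr) auto
  also have "\<dots> = exp (of_real (v - u) * g z)"
    using uv by (intro exp_S) auto
  finally show "(\<integral>\<omega>. exp (z * of_real (S v \<omega> - S u \<omega>)) \<partial>N) = exp (of_real (v - u) * g z)" .
qed

text \<open>Plays the role of a Markov property: \<open>W\<close> carries whatever is known at time
  u, and the increment after u contributes a deterministic factor.\<close>

lemma past_times_exp_increment:
  assumes uv: "0 \<le> u" "u \<le> v" and W: "W \<in> borel_measurable (past u)" "integrable N W"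
  shows "integrable N (\<lambda>\<omega>. W \<omega> * exp (c * of_real (S v \<omega> - S u \<omega>)))"
    and "(\<integral>\<omega>. W \<omega> * exp (c * of_real (S v \<omega> - S u \<omega>)) \<partial>N)
      = (\<integral>\<omega>. W \<omega> \<partial>N) * exp (of_real (v - u) * g c)"
proof -
  let ?X = "\<lambda>\<omega>. exp (c * of_real (S v \<omega> - S u \<omega>))"
  have [measurable]: "S u \<in> borel_measurable N" "S v \<in> borel_measurable N"
    using uv by (auto intro: S_measurable)
  have indep: "indep_var borel W borel ?X"
    unfolding indep_var_eq
  proof (intro conjI)
    show "random_variable borel W" using W by auto
    show "random_variable borel ?X" by measurable
    show "indep_set (sigma_sets (space N) {W -` A \<inter> space N | A. A \<in> sets borel})
        (sigma_sets (space N) {?X -` A \<inter> space N | A. A \<in> sets borel})"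
    proof (rule indep_set_subset[OF increment_indep_past[OF uv]])
      have "{W -` A \<inter> space N | A. A \<in> sets borel} \<subseteq> sets (past u)"
        using measurable_sets[OF W(1)] by auto
      from sets.sigma_sets_subset[OF this]
      show "sigma_sets (space N) {W -` A \<inter> space N | A. A \<in> sets borel} \<subseteq> sets (past u)" by simp
      show "sigma_sets (space N) {?X -` A \<inter> space N | A. A \<in> sets borel}
          \<subseteq> sigma_sets (space N) {(\<lambda>\<omega>. S v \<omega> - S u \<omega>) -` C \<inter> space N | C. C \<in> sets borel}"
      proof (rule sigma_sets_mono', rule subsetI)
        fix x assume "x \<in> {?X -` A \<inter> space N | A. A \<in> sets borel}"
        then obtain A :: "complex set" where A: "x = ?X -` A \<inter> space N" "A \<in> sets borel" by auto
        have "(\<lambda>y::real. exp (c * of_real y)) \<in> borel_measurable borel" by measurable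
        from measurable_sets[OF this A(2)] have "(\<lambda>y::real. exp (c * of_real y)) -` A \<in> sets borel" by simp
        moreover have "x = (\<lambda>\<omega>. S v \<omega> - S u \<omega>) -` ((\<lambda>y::real. exp (c * of_real y)) -` A) \<inter> space N"
          unfolding A(1) by auto
        ultimately show "x \<in> {(\<lambda>\<omega>. S v \<omega> - S u \<omega>) -` C \<inter> space N | C. C \<in> sets borel}" by blast
      qed
    qed
  qed
  show "integrable N (\<lambda>\<omega>. W \<omega> * ?X \<omega>)"
    by (rule indep_var_integrable[OF indep W(2) exp_increment(1)[OF uv]])
  show "(\<integral>\<omega>. W \<omega> * ?X \<omega> \<partial>N) = (\<integral>\<omega>. W \<omega> \<partial>N) * exp (of_real (v - u) * g c)"
    using indep_var_lebesgue_integral[OF indep W(2) exp_increment(1)[OF uv]] exp_increment(2)[OF uv, of c]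
    by (simp only:)
qed

text \<open>The last increment is split off by induction. Measurability of the product for the past
  at the end of the grid is part of the claim because the next step needs it.\<close>

lemma past_times_prod_exp_increments:
  assumes s: "0 \<le> s" and h: "0 \<le> h" and W: "W \<in> borel_measurable (past s)" "integrable N W"
  shows "(\<lambda>\<omega>. W \<omega> * (\<Prod>j<m. exp (c j * of_real (S (s + real (Suc j) * h) \<omega> - S (s + real j * h) \<omega>))))
      \<in> borel_measurable (past (s + real m * h)) \<and>
    integrable N (\<lambda>\<omega>. W \<omega> * (\<Prod>j<m. exp (c j * of_real (S (s + real (Suc j) * h) \<omega> - S (s + real j * h) \<omega>)))) \<and>
    (\<integral>\<omega>. W \<omega> * (\<Prod>j<m. exp (c j * of_real (S (s + real (Suc j) * h) \<omega> - S (s + real j * h) \<omega>))) \<partial>N)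
      = (\<integral>\<omega>. W \<omega> \<partial>N) * (\<Prod>j<m. exp (of_real h * g (c j)))"
proof (induction m)
  case 0
  then show ?case using W by simp
next
  case (Suc m)
  let ?V = "\<lambda>m \<omega>. W \<omega> * (\<Prod>j<m. exp (c j * of_real (S (s + real (Suc j) * h) \<omega> - S (s + real j * h) \<omega>)))"
  let ?u = "s + real m * h" and ?v = "s + real (Suc m) * h"
  have uv: "0 \<le> ?u" "?u \<le> ?v" "?v - ?u = h" using s h by (auto simp: algebra_simps)
  have V_Suc: "?V (Suc m) = (\<lambda>\<omega>. ?V m \<omega> * exp (c m * of_real (S ?v \<omega> - S ?u \<omega>)))"
    by (simp add: fun_eq_iff mult.assoc)
  have meas: "?V m \<in> borel_measurable (past ?u)" and int: "integrable N (?V m)"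
    and eq: "(\<integral>\<omega>. ?V m \<omega> \<partial>N) = (\<integral>\<omega>. W \<omega> \<partial>N) * (\<Prod>j<m. exp (of_real h * g (c j)))"
    using Suc.IH by blast+
  have V_meas: "?V m \<in> borel_measurable (past ?v)" by (rule past_measurable_mono[OF uv(2) meas])
  have [measurable]: "S ?u \<in> borel_measurable (past ?v)" "S ?v \<in> borel_measurable (past ?v)"
    using uv by (auto intro!: S_past_measurable simp del: of_nat_Suc)
  have E_meas: "(\<lambda>\<omega>. exp (c m * of_real (S ?v \<omega> - S ?u \<omega>))) \<in> borel_measurable (past ?v)"
    by measurable
  show ?case
  proof (intro conjI)
    show "?V (Suc m) \<in> borel_measurable (past ?v)"
      unfolding V_Suc by (rule borel_measurable_times[OF V_meas E_meas])
    show "integrable N (?V (Suc m))"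
      unfolding V_Suc by (rule past_times_exp_increment(1)[OF uv(1,2) meas int])
    show "(\<integral>\<omega>. ?V (Suc m) \<omega> \<partial>N) = (\<integral>\<omega>. W \<omega> \<partial>N) * (\<Prod>j<Suc m. exp (of_real h * g (c j)))"
      unfolding V_Suc past_times_exp_increment(2)[OF uv(1,2) meas int] eq uv(3)
      by (simp only: prod.lessThan_Suc mult.assoc)
  qed
qed

text \<open>Subtracting (t - s) S s makes the exponent depend on increments after s alone. In the
  Riemann sum an increment is weighted by the time remaining after it, so the product formula
  evaluates g at z plus that remaining time, and the exponents form a Riemann sum of g from z to z +
  t - s.\<close>

lemma past_times_exp_functional:
  fixes W :: "'a \<Rightarrow> complex" and z :: complex
  assumes st: "0 \<le> s" "s \<le> t" and W: "W \<in> borel_measurable (past s)" "integrable N W"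
  defines "V \<equiv> \<lambda>\<omega>. W \<omega> * exp (of_real ((\<integral>x\<in>{s..t}. S x \<omega> \<partial>lborel) - (t - s) * S s \<omega>)
                        + z * of_real (S t \<omega> - S s \<omega>))"
  shows "integrable N V"
    and "(\<integral>\<omega>. V \<omega> \<partial>N) = (\<integral>\<omega>. W \<omega> \<partial>N) * exp (G (z + of_real (t - s)) - G z)"
proof -
  define \<tau> where "\<tau> = t - s"
  have \<tau>: "0 \<le> \<tau>" using st by (simp add: \<tau>_def)
  define h where "h n = \<tau> / real (Suc n)" for n
  have h: "0 \<le> h n" for n using \<tau> by (simp add: h_def)
  define R where "R n \<omega> = (\<Sum>k<Suc n. h n * S (s + real k * h n) \<omega>) - \<tau> * S s \<omega>" for n \<omega>
  \<comment> \<open>Increment j lies below the left grid points j + 1, ..., n of the n + 1 cells,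
    hence the weight n - j, besides the z from the total increment.\<close>
  define c where "c n j = z + of_real (h n * real (n - j))" for n j
  let ?D = "\<lambda>n j \<omega>. S (s + real (Suc j) * h n) \<omega> - S (s + real j * h n) \<omega>"
  have end_eq: "s + real (Suc n) * h n = t" for n by (simp add: h_def \<tau>_def)
  have hn: "real (Suc n) * h n = \<tau>" for n by (simp add: h_def)
  have R_eq: "R n \<omega> = h n * (\<Sum>k<Suc n. S (s + real k * h n) \<omega> - S s \<omega>)" for n \<omega>
  proof -
    have "R n \<omega> = (\<Sum>k<Suc n. h n * S (s + real k * h n) \<omega>) - (real (Suc n) * h n) * S s \<omega>"
      unfolding hn R_def ..
    also have "\<dots> = (\<Sum>k<Suc n. h n * S (s + real k * h n) \<omega>) - (\<Sum>k<Suc n. h n * S s \<omega>)"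
      by (simp only: sum_constant card_lessThan mult.assoc)
    finally show ?thesis
      by (simp only: sum_distrib_left right_diff_distrib sum_subtractf)
  qed
  have R_incr: "R n \<omega> = (\<Sum>j<Suc n. h n * real (n - j) * ?D n j \<omega>)" for n \<omega>
    using sum_diff_first_eq_weighted_increments[of "\<lambda>k. S (s + real k * h n) \<omega>" "Suc n"]
    by (simp add: R_eq sum_distrib_left mult.assoc del: sum.lessThan_Suc of_nat_Suc)
  have Z_incr: "S t \<omega> - S s \<omega> = (\<Sum>j<Suc n. ?D n j \<omega>)" for n \<omega>
    using sum_lessThan_telescope[of "\<lambda>k. S (s + real k * h n) \<omega>" "Suc n"] end_eq[of n] by simp
  have exp_R: "exp (of_real (R n \<omega>) + z * of_real (S t \<omega> - S s \<omega>)) = (\<Prod>j<Suc n. exp (c n j * of_real (?D n j \<omega>)))" for n \<omega>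
  proof -
    have "of_real (R n \<omega>) + z * of_real (S t \<omega> - S s \<omega>) = (\<Sum>j<Suc n. c n j * of_real (?D n j \<omega>))"
      unfolding R_incr[of n] Z_incr[of _ n] c_def
      by (simp only: of_real_sum sum_distrib_left sum.distrib[symmetric] distrib_right of_real_mult add.commute)
    then show ?thesis by (simp only: exp_sum[OF finite_lessThan])
  qed
  have int_R: "(\<integral>\<omega>. W \<omega> * exp (of_real (R n \<omega>) + z * of_real (S t \<omega> - S s \<omega>)) \<partial>N)
      = (\<integral>\<omega>. W \<omega> \<partial>N) * exp (\<Sum>k<Suc n. of_real (h n) * g (z + of_real (real k * h n)))" for n
  proof -
    have "(\<integral>\<omega>. W \<omega> * exp (of_real (R n \<omega>) + z * of_real (S t \<omega> - S s \<omega>)) \<partial>N)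
        = (\<integral>\<omega>. W \<omega> \<partial>N) * (\<Prod>j<Suc n. exp (of_real (h n) * g (c n j)))"
      using past_times_prod_exp_increments[OF st(1) h[of n] W, where m="Suc n" and c="c n"] unfolding exp_R by blast
    also have "(\<Prod>j<Suc n. exp (of_real (h n) * g (c n j))) = exp (\<Sum>j<Suc n. of_real (h n) * g (c n j))"
      by (rule exp_sum[OF finite_lessThan, symmetric])
    \<comment> \<open>Reversal of the order of summation, j to n - j.\<close>
    also have "(\<Sum>j<Suc n. of_real (h n) * g (c n j)) = (\<Sum>k<Suc n. of_real (h n) * g (z + of_real (real k * h n)))"
      unfolding c_def by (subst sum.nat_diff_reindex[symmetric]) (simp add: mult.commute)
    finally show ?thesis .
  qed
  have R_le: "R n \<omega> \<le> \<tau> * (S t \<omega> - S s \<omega>)" if \<omega>: "\<omega> \<in> space N" for n \<omega>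
  proof -
    have "(\<Sum>k<Suc n. S (s + real k * h n) \<omega> - S s \<omega>) \<le> (\<Sum>k<Suc n. S t \<omega> - S s \<omega>)"
    proof (rule sum_mono)
      fix k assume "k \<in> {..<Suc n}"
      then have "s + real k * h n \<le> t" "0 \<le> s + real k * h n"
        using grid_in_Icc[of s t k n] st h[of n] by (auto simp: h_def \<tau>_def)
      then show "S (s + real k * h n) \<omega> - S s \<omega> \<le> S t \<omega> - S s \<omega>" using S_mono[OF \<omega>] by simp
    qed
    then have "R n \<omega> \<le> h n * (real (Suc n) * (S t \<omega> - S s \<omega>))"
      unfolding R_eq using h[of n] by (intro mult_left_mono) (auto simp del: sum.lessThan_Suc)
    also have "\<dots> = \<tau> * (S t \<omega> - S s \<omega>)" using hn[of n] by (simp add: mult.commute mult.left_commute)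
    finally show ?thesis .
  qed
  \<comment> \<open>Monotone paths give R n <= \<tau> (S t - S s) for all n, and Re z <= |z|. The
    majorant is phrased as a norm of a complex product so that its integrability is an instance of
    \<open>past_times_exp_increment\<close>.\<close>
  let ?w = "\<lambda>\<omega>. norm (of_real (norm (W \<omega>)) * exp (of_real (\<tau> + norm z) * of_real (S t \<omega> - S s \<omega>) :: complex))"
  have int_w: "integrable N ?w"
    using st W by (intro integrable_norm past_times_exp_increment(1)) auto
  have R_lim: "(\<lambda>n. R n \<omega>) \<longlonglongrightarrow> (\<integral>x\<in>{s..t}. S x \<omega> \<partial>lborel) - (t - s) * S s \<omega>" if "\<omega> \<in> space N" for \<omega>
    unfolding R_def h_def \<tau>_def using integral_S_riemann[OF st that] by (intro tendsto_intros)
  have [measurable]: "S s \<in> borel_measurable N" "S t \<in> borel_measurable N" "W \<in> borel_measurable N"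
    using st W by (auto intro: S_measurable)
  have [measurable]: "(\<lambda>\<omega>. \<integral>x\<in>{s..t}. S x \<omega> \<partial>lborel) \<in> borel_measurable N"
    by (rule past_measurable_N[OF integral_S_past_measurable[OF st]])
  have [measurable]: "R n \<in> borel_measurable N" for n
    unfolding R_def using st h[of n]
    by (intro borel_measurable_diff borel_measurable_sum borel_measurable_times borel_measurable_const S_measurable) auto
  have V_meas: "V \<in> borel_measurable N" unfolding V_def by measurable
  have V_lim: "AE \<omega> in N. (\<lambda>n. W \<omega> * exp (of_real (R n \<omega>) + z * of_real (S t \<omega> - S s \<omega>))) \<longlonglongrightarrow> V \<omega>"
    unfolding V_def by (intro AE_I2 tendsto_intros R_lim)
  have V_dom: "AE \<omega> in N. norm (W \<omega> * exp (of_real (R n \<omega>) + z * of_real (S t \<omega> - S s \<omega>))) \<le> ?w \<omega>" for n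
  proof (rule AE_I2)
    fix \<omega> assume \<omega>: "\<omega> \<in> space N"
    have "0 \<le> S t \<omega> - S s \<omega>" using S_mono[OF \<omega> st] by simp
    then have "Re z * (S t \<omega> - S s \<omega>) \<le> norm z * (S t \<omega> - S s \<omega>)"
      by (intro mult_right_mono complex_Re_le_cmod)
    with R_le[OF \<omega>, of n] have "R n \<omega> + Re z * (S t \<omega> - S s \<omega>) \<le> (\<tau> + norm z) * (S t \<omega> - S s \<omega>)"
      by (simp only: distrib_right add_mono)
    then show "norm (W \<omega> * exp (of_real (R n \<omega>) + z * of_real (S t \<omega> - S s \<omega>))) \<le> ?w \<omega>"
      by (simp add: norm_mult mult_left_mono)
  qed
  show "integrable N V"
    by (rule integrable_dominated_convergence[OF V_meas _ int_w V_lim V_dom]) measurable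
  have "(\<lambda>n. \<integral>\<omega>. W \<omega> * exp (of_real (R n \<omega>) + z * of_real (S t \<omega> - S s \<omega>)) \<partial>N) \<longlonglongrightarrow> (\<integral>\<omega>. V \<omega> \<partial>N)"
    by (rule integral_dominated_convergence[OF V_meas _ int_w V_lim V_dom]) measurable
  moreover have "(\<lambda>n. (\<integral>\<omega>. W \<omega> \<partial>N) * exp (\<Sum>k<Suc n. of_real (h n) * g (z + of_real (real k * h n))))
      \<longlonglongrightarrow> (\<integral>\<omega>. W \<omega> \<partial>N) * exp (G (z + of_real \<tau>) - G z)"
    unfolding h_def by (intro tendsto_intros holomorphic_riemann_sum_tendsto G_deriv hol_g \<tau>)
  ultimately show "(\<integral>\<omega>. V \<omega> \<partial>N) = (\<integral>\<omega>. W \<omega> \<partial>N) * exp (G (z + of_real (t - s)) - G z)"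
    unfolding int_R \<tau>_def by (rule LIMSEQ_unique)
qed

end

section \<open>The unkilled process\<close>

context levy_subordinator
begin

lemma S_set_integrable:
  assumes "0 \<le> s" "\<omega> \<in> space N"
  shows "set_integrable lborel {s..t} (\<lambda>x. S x \<omega>)"
  using S_mono assms by (intro set_integrable_mono_Icc) auto

lemma integral_S_split:
  assumes "0 \<le> s" "s \<le> t" "\<omega> \<in> space N"
  shows "(\<integral>x\<in>{0..t}. S x \<omega> \<partial>lborel) = (\<integral>x\<in>{0..s}. S x \<omega> \<partial>lborel) + (\<integral>x\<in>{s..t}. S x \<omega> \<partial>lborel)"
proof -
  have eq: "(\<integral>x\<in>{u..v}. S x \<omega> \<partial>lborel) = integral {u..v} (\<lambda>x. S x \<omega>)" if "0 \<le> u" for u v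
    by (rule set_borel_integral_eq_integral(2)[OF S_set_integrable[OF that assms(3)]])
  have "(\<lambda>x. S x \<omega>) integrable_on {0..t}"
    by (rule set_borel_integral_eq_integral(1)[OF S_set_integrable[OF _ assms(3)]]) simp
  from Henstock_Kurzweil_Integration.integral_combine[OF assms(1,2) this]
  show ?thesis using assms by (simp add: eq)
qed

lemma integral_S_le:
  assumes "0 \<le> t" "\<omega> \<in> space N"
  shows "(\<integral>x\<in>{0..t}. S x \<omega> \<partial>lborel) \<le> t * S t \<omega>"
proof -
  have "(\<integral>x\<in>{0..t}. S x \<omega> \<partial>lborel) = integral {0..t} (\<lambda>x. S x \<omega>)"
    by (rule set_borel_integral_eq_integral(2)[OF S_set_integrable[OF _ assms(2)]]) simp
  also have "\<dots> \<le> integral {0..t} (\<lambda>_. S t \<omega>)"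
  proof (rule integral_le)
    show "(\<lambda>x. S x \<omega>) integrable_on {0..t}"
      by (rule set_borel_integral_eq_integral(1)[OF S_set_integrable[OF _ assms(2)]]) simp
  qed (use assms S_mono in auto)
  also have "\<dots> = t * S t \<omega>" using assms by simp
  finally show ?thesis .
qed

end

context exp_subordinator
begin

lemma exp_real_S_integrable: "0 \<le> t \<Longrightarrow> integrable N (\<lambda>\<omega>. exp (u * S t \<omega>))"
  using integrable_norm[OF exp_S(1)[of t "of_real u"]] by simp

lemma exp_integral_S_integrable:
  assumes "0 \<le> t" "0 \<le> u"
  shows "integrable N (\<lambda>\<omega>. exp ((\<integral>x\<in>{0..t}. S x \<omega> \<partial>lborel) + u * S t \<omega>))"
proof (rule Bochner_Integration.integrable_bound[OF exp_real_S_integrable[OF assms(1), of "t + u"]])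
  have [measurable]: "S t \<in> borel_measurable N" "(\<lambda>\<omega>. \<integral>x\<in>{0..t}. S x \<omega> \<partial>lborel) \<in> borel_measurable N"
    using assms by (auto intro!: S_measurable past_measurable_N[OF integral_S_past_measurable])
  show "(\<lambda>\<omega>. exp ((\<integral>x\<in>{0..t}. S x \<omega> \<partial>lborel) + u * S t \<omega>)) \<in> borel_measurable N"
    by measurable
  show "AE \<omega> in N. norm (exp ((\<integral>x\<in>{0..t}. S x \<omega> \<partial>lborel) + u * S t \<omega>)) \<le> norm (exp ((t + u) * S t \<omega>))"
    using integral_S_le[OF assms(1)] by (intro AE_I2) (simp add: distrib_right)
qed

text \<open>With \<tau> = t - s, integrating out the increments after s multiplies H(i l) by exp
  (G(i l + \<tau>) - G(i l)), which gives exp (a \<tau>) H(\<tau> + i l), and leaves a factor exp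
  (\<tau> S s). This factor is exactly what turns the integrand into exp (z S s) H(z) on the line Re
  z = \<tau>, so the shift back to Re z = 0 restores q(- S s). The event \<open>B\<close> stands in
  for conditioning at time s.\<close>

lemma fourier_exp_integral_martingale:
  fixes a :: real and H :: "complex \<Rightarrow> complex" and q :: "real \<Rightarrow> complex"
  defines "H \<equiv> \<lambda>z. exp (G z - of_real a * z)"
    and "q \<equiv> \<lambda>x. (\<integral>l. iexp (- (l * x)) * H (\<i> * of_real l) \<partial>lborel) / (2 * pi)"
  assumes st: "0 \<le> s" "s \<le> t" and B: "B \<in> sets (past s)"
    and H_int: "integrable lborel (\<lambda>l. norm (H (\<i> * of_real l)))"
    and H_lim: "((\<lambda>l. norm (H (\<i> * of_real l))) \<longlongrightarrow> 0) at_infinity"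
    and H_bound: "\<And>u l. 0 \<le> u \<Longrightarrow> u \<le> t \<Longrightarrow> norm (H (of_real u + \<i> * of_real l)) \<le> C * norm (H (\<i> * of_real l))"
  shows "(\<integral>\<omega>. indicator B \<omega> * of_real (exp (\<integral>x\<in>{0..t}. S x \<omega> \<partial>lborel)) * q (- S t \<omega>) \<partial>N)
    = of_real (exp (a * (t - s))) *
      (\<integral>\<omega>. indicator B \<omega> * of_real (exp (\<integral>x\<in>{0..s}. S x \<omega> \<partial>lborel)) * q (- S s \<omega>) \<partial>N)"
proof -
  interpret P: pair_sigma_finite N lborel ..
  define \<tau> where "\<tau> = t - s"
  have \<tau>: "0 \<le> \<tau>" "\<tau> \<le> t" using st by (auto simp: \<tau>_def)
  define I where "I r \<omega> = (\<integral>x\<in>{0..r}. S x \<omega> \<partial>lborel)" for r \<omega>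
  have G_hol: "G holomorphic_on UNIV"
    using G_deriv by (auto simp: holomorphic_on_def field_differentiable_def intro: has_field_derivative_at_within)
  have H_hol: "H holomorphic_on UNIV"
    unfolding H_def by (intro holomorphic_intros G_hol)
  have H_line: "(\<lambda>l. H (w + \<i> * of_real l)) \<in> borel_measurable borel" for w
    by (rule borel_measurable_continuous_onI)
       (intro continuous_on_compose2[OF holomorphic_on_imp_continuous_on[OF H_hol]] continuous_intros, auto)
  have [measurable]: "(\<lambda>l. H (of_real \<tau> + \<i> * of_real l)) \<in> borel_measurable borel"
    "(\<lambda>l. H (\<i> * of_real l)) \<in> borel_measurable borel"
    using H_line[of "of_real \<tau>"] H_line[of 0] by simp_all
  have [measurable]: "S s \<in> borel_measurable N" "S t \<in> borel_measurable N"
    using st by (auto intro: S_measurable)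
  have [measurable]: "I s \<in> borel_measurable N" "I t \<in> borel_measurable N"
    unfolding I_def using st by (auto intro!: past_measurable_N[OF integral_S_past_measurable])
  have [measurable]: "B \<in> sets N" using B past_subset_events by auto
  have B_past: "B \<in> sets (past s)" by (rule B)
  have [measurable]: "S s \<in> borel_measurable (past s)" "I s \<in> borel_measurable (past s)"
    unfolding I_def using st by (auto intro!: S_past_measurable integral_S_past_measurable)

  \<comment> \<open>The part of exp (I t + i l S t) known at time s: over (s, t] the integral
    contributes \<tau> S s plus a functional of later increments.\<close>
  define W where "W l \<omega> = indicator B \<omega> * exp (of_real (I s \<omega>) + (of_real \<tau> + \<i> * of_real l) * of_real (S s \<omega>))" for l \<omega>
  have W_past: "W l \<in> borel_measurable (past s)" for l
    unfolding W_def using B_past by measurable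
  have W_int: "integrable N (W l)" for l
  proof (rule Bochner_Integration.integrable_bound[OF exp_integral_S_integrable[OF st(1) \<tau>(1)]])
    show "AE \<omega> in N. norm (W l \<omega>) \<le> norm (exp ((\<integral>x\<in>{0..s}. S x \<omega> \<partial>lborel) + \<tau> * S s \<omega>))"
      by (intro AE_I2) (simp add: W_def I_def norm_mult indicator_def)
  qed (rule past_measurable_N[OF W_past])
  let ?Q = "\<lambda>\<omega>. (\<integral>x\<in>{s..t}. S x \<omega> \<partial>lborel) - (t - s) * S s \<omega>"
  have W_eq: "indicator B \<omega> * exp (of_real (I t \<omega>) + \<i> * of_real l * of_real (S t \<omega>))
      = W l \<omega> * exp (of_real (?Q \<omega>) + \<i> * of_real l * of_real (S t \<omega> - S s \<omega>))" if "\<omega> \<in> space N" for l \<omega>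
    unfolding W_def mult.assoc mult_exp_exp I_def integral_S_split[OF st that] \<tau>_def
    by (simp add: algebra_simps)

  have "(\<integral>\<omega>. indicator B \<omega> * of_real (exp (I t \<omega>)) * (\<integral>l. iexp (- (l * (- S t \<omega>))) * H (\<i> * of_real l) \<partial>lborel) \<partial>N)
      = (\<integral>\<omega>. (\<integral>l. indicator B \<omega> * exp (of_real (I t \<omega>) + \<i> * of_real l * of_real (S t \<omega>)) * H (\<i> * of_real l) \<partial>lborel) \<partial>N)"
    unfolding integral_mult_right_zero[symmetric]
    by (simp add: exp_add exp_of_real mult_ac)
  also have "\<dots> = (\<integral>l. (\<integral>\<omega>. indicator B \<omega> * exp (of_real (I t \<omega>) + \<i> * of_real l * of_real (S t \<omega>)) * H (\<i> * of_real l) \<partial>N) \<partial>lborel)"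
  proof (rule P.Fubini_integral[symmetric])
    \<comment> \<open>Majorant for Fubini: exp (I t) times |H(i l)|, since exp (i l S t) has modulus
      1.\<close>
    have "integrable N (\<lambda>\<omega>. exp (I t \<omega>))"
      using exp_integral_S_integrable[of t 0] st by (simp add: I_def)
    then show "integrable (N \<Otimes>\<^sub>M lborel)
        (\<lambda>(\<omega>, l). indicator B \<omega> * exp (of_real (I t \<omega>) + \<i> * of_real l * of_real (S t \<omega>)) * H (\<i> * of_real l))"
      by (rule P.integrable_dominated_by_product[OF _ H_int]) (auto simp: norm_mult indicator_def)
  qed
  also have "\<dots> = (\<integral>l. (\<integral>\<omega>. W l \<omega> \<partial>N) * (of_real (exp (a * \<tau>)) * H (of_real \<tau> + \<i> * of_real l)) \<partial>lborel)"
  proof (rule Bochner_Integration.integral_cong[OF refl])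
    fix l :: real
    have "(\<integral>\<omega>. indicator B \<omega> * exp (of_real (I t \<omega>) + \<i> * of_real l * of_real (S t \<omega>)) * H (\<i> * of_real l) \<partial>N)
        = (\<integral>\<omega>. W l \<omega> * exp (of_real (?Q \<omega>) + \<i> * of_real l * of_real (S t \<omega> - S s \<omega>)) \<partial>N) * H (\<i> * of_real l)"
      using W_eq by (simp cong: Bochner_Integration.integral_cong)
    also have "\<dots> = (\<integral>\<omega>. W l \<omega> \<partial>N) * (exp (G (\<i> * of_real l + of_real (t - s)) - G (\<i> * of_real l)) * H (\<i> * of_real l))"
      unfolding past_times_exp_functional(2)[OF st W_past W_int] by (rule mult.assoc)
    \<comment> \<open>The terms G(i l) cancel; passing from G to log H at \<tau> + i l instead of i
      l leaves the surplus a \<tau>.\<close>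
    also have "exp (G (\<i> * of_real l + of_real (t - s)) - G (\<i> * of_real l)) * H (\<i> * of_real l)
        = of_real (exp (a * \<tau>)) * H (of_real \<tau> + \<i> * of_real l)"
      unfolding H_def \<tau>_def exp_of_real[symmetric] mult_exp_exp by (simp add: algebra_simps)
    finally show "(\<integral>\<omega>. indicator B \<omega> * exp (of_real (I t \<omega>) + \<i> * of_real l * of_real (S t \<omega>)) * H (\<i> * of_real l) \<partial>N)
        = (\<integral>\<omega>. W l \<omega> \<partial>N) * (of_real (exp (a * \<tau>)) * H (of_real \<tau> + \<i> * of_real l))" .
  qed
  also have "\<dots> = of_real (exp (a * \<tau>)) * (\<integral>l. (\<integral>\<omega>. W l \<omega> * H (of_real \<tau> + \<i> * of_real l) \<partial>N) \<partial>lborel)"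
    unfolding integral_mult_left_zero integral_mult_right_zero[symmetric] by (simp only: mult_ac)
  also have "(\<integral>l. (\<integral>\<omega>. W l \<omega> * H (of_real \<tau> + \<i> * of_real l) \<partial>N) \<partial>lborel)
      = (\<integral>\<omega>. (\<integral>l. W l \<omega> * H (of_real \<tau> + \<i> * of_real l) \<partial>lborel) \<partial>N)"
  proof (rule P.Fubini_integral)
    have int_C: "integrable lborel (\<lambda>l. C * norm (H (\<i> * of_real l)))"
      using H_int by simp
    show "integrable (N \<Otimes>\<^sub>M lborel) (\<lambda>(\<omega>, l). W l \<omega> * H (of_real \<tau> + \<i> * of_real l))"
    proof (rule P.integrable_dominated_by_product[OF exp_integral_S_integrable[OF st(1) \<tau>(1)] int_C])
      show "(\<lambda>(\<omega>, l). W l \<omega> * H (of_real \<tau> + \<i> * of_real l)) \<in> borel_measurable (N \<Otimes>\<^sub>M lborel)"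
        unfolding W_def by measurable
      show "norm (case (\<omega>, l) of (\<omega>, l) \<Rightarrow> W l \<omega> * H (of_real \<tau> + \<i> * of_real l))
          \<le> exp ((\<integral>x\<in>{0..s}. S x \<omega> \<partial>lborel) + \<tau> * S s \<omega>) * (C * norm (H (\<i> * of_real l)))" for \<omega> l
        unfolding prod.case norm_mult
        by (intro mult_mono H_bound \<tau>) (auto simp: W_def I_def norm_mult indicator_def)
    qed
  qed
  also have "\<dots> = (\<integral>\<omega>. indicator B \<omega> * of_real (exp (I s \<omega>)) * (\<integral>l. iexp (- (l * (- S s \<omega>))) * H (\<i> * of_real l) \<partial>lborel) \<partial>N)"
  proof (rule Bochner_Integration.integral_cong[OF refl])
    fix \<omega> assume \<omega>: "\<omega> \<in> space N"
    define x where "x = S s \<omega>"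
    have x: "0 \<le> x" using S_nonneg[OF \<omega> st(1)] by (simp add: x_def)
    \<comment> \<open>For fixed \<omega> the shift is applied to the entire function exp (z x) H(z);
      as x >= 0, the factor exp (u x) stays below exp (\<tau> x) in the strip.\<close>
    have "(\<integral>l. exp ((of_real \<tau> + \<i> * of_real l) * of_real x) * H (of_real \<tau> + \<i> * of_real l) \<partial>lborel)
        = (\<integral>l. exp ((\<i> * of_real l) * of_real x) * H (\<i> * of_real l) \<partial>lborel)"
    proof (rule vertical_line_integral_shift[where H="\<lambda>z. exp (z * of_real x) * H z" and B="\<lambda>l. exp (\<tau> * x) * (C * norm (H (\<i> * of_real l)))"])
      show "(\<lambda>z. exp (z * of_real x) * H z) holomorphic_on UNIV"
        by (intro holomorphic_intros H_hol)
      show "norm (exp ((of_real u + \<i> * of_real l) * of_real x) * H (of_real u + \<i> * of_real l))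
          \<le> exp (\<tau> * x) * (C * norm (H (\<i> * of_real l)))" if "0 \<le> u" "u \<le> \<tau>" for u l
        unfolding norm_mult
        using that x \<tau> by (intro mult_mono H_bound) (auto intro: mult_right_mono)
      show "((\<lambda>l. exp (\<tau> * x) * (C * norm (H (\<i> * of_real l)))) \<longlongrightarrow> 0) at_infinity"
        by (intro tendsto_mult_right_zero H_lim)
    qed (use \<tau> H_int in auto)
    then have "(\<integral>l. W l \<omega> * H (of_real \<tau> + \<i> * of_real l) \<partial>lborel)
        = indicator B \<omega> * exp (of_real (I s \<omega>)) * (\<integral>l. exp ((\<i> * of_real l) * of_real x) * H (\<i> * of_real l) \<partial>lborel)"
      unfolding W_def exp_add mult.assoc integral_mult_right_zero x_def by simp
    then show "(\<integral>l. W l \<omega> * H (of_real \<tau> + \<i> * of_real l) \<partial>lborel)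
        = indicator B \<omega> * of_real (exp (I s \<omega>)) * (\<integral>l. iexp (- (l * (- S s \<omega>))) * H (\<i> * of_real l) \<partial>lborel)"
      by (simp add: x_def exp_of_real mult.assoc)
  qed
  finally show ?thesis
    unfolding q_def I_def \<tau>_def by (simp only: times_divide_eq_right integral_divide_zero)
qed

end

section \<open>Killing\<close>

locale killed_levy_subordinator = levy_subordinator +
  fixes \<kappa> :: real and \<zeta> :: "'a \<Rightarrow> ereal" and \<sigma> :: "real \<Rightarrow> 'a \<Rightarrow> ereal"
  assumes \<zeta>_measurable: "\<zeta> \<in> borel_measurable N"
    and \<zeta>_exponential: "\<And>t. 0 \<le> t \<Longrightarrow> prob {\<omega>\<in>space N. ereal t < \<zeta> \<omega>} = exp (- \<kappa> * t)"
    and \<zeta>_indep: "indep_set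
        (sigma_sets (space N) {\<zeta> -` A \<inter> space N | A. A \<in> sets borel})
        (sigma_sets (space N) {S t -` A \<inter> space N | t A. 0 \<le> t \<and> A \<in> sets borel})"
    and \<sigma>_eq: "\<And>\<omega> t. \<omega> \<in> space N \<Longrightarrow> 0 \<le> t \<Longrightarrow>
        \<sigma> t \<omega> = (if ereal t < \<zeta> \<omega> then ereal (S t \<omega>) else \<infinity>)"
begin

definition alive :: "real \<Rightarrow> 'a set" where
  "alive t = {\<omega>\<in>space N. ereal t < \<zeta> \<omega>}"

lemma alive_eq_vimage: "alive t = \<zeta> -` {ereal t<..} \<inter> space N"
  by (auto simp: alive_def)

lemma alive_sets [measurable]: "alive t \<in> events"
  unfolding alive_eq_vimage by (rule measurable_sets[OF \<zeta>_measurable]) simp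

lemma prob_alive: "0 \<le> t \<Longrightarrow> prob (alive t) = exp (- \<kappa> * t)"
  unfolding alive_def by (rule \<zeta>_exponential)

lemma \<sigma>_alive: "\<omega> \<in> alive t \<Longrightarrow> 0 \<le> r \<Longrightarrow> r \<le> t \<Longrightarrow> \<sigma> r \<omega> = ereal (S r \<omega>)"
  using le_less_trans[of "ereal r" "ereal t" "\<zeta> \<omega>"] by (auto simp: alive_def \<sigma>_eq)

lemma \<sigma>_not_alive: "\<omega> \<in> space N \<Longrightarrow> 0 \<le> t \<Longrightarrow> \<omega> \<notin> alive t \<Longrightarrow> \<sigma> t \<omega> = \<infinity>"
  by (auto simp: alive_def \<sigma>_eq)

text \<open>The killing time is independent of the whole path of S, so t and u need not be related:
  survival up to t contributes just its probability.\<close>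

lemma integral_alive_times_past:
  fixes X :: "'a \<Rightarrow> complex"
  assumes t: "0 \<le> t" and X: "X \<in> borel_measurable (past u)" "integrable N X"
  shows "(\<integral>\<omega>. indicator (alive t) \<omega> * X \<omega> \<partial>N) = of_real (exp (- \<kappa> * t)) * (\<integral>\<omega>. X \<omega> \<partial>N)"
proof -
  let ?I = "\<lambda>\<omega>. indicator (alive t) \<omega> :: complex"
  have int_I: "integrable N ?I"
    by (rule integrable_const_bound[where B=1]) (auto simp: indicator_def)
  have indep: "indep_var borel ?I borel X"
    unfolding indep_var_eq
  proof (intro conjI)
    show "random_variable borel ?I" by measurable
    show "random_variable borel X" using X by auto
    show "indep_set (sigma_sets (space N) {?I -` A \<inter> space N | A. A \<in> sets borel})
        (sigma_sets (space N) {X -` A \<inter> space N | A. A \<in> sets borel})"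
    proof (rule indep_set_subset[OF \<zeta>_indep])
      show "sigma_sets (space N) {?I -` A \<inter> space N | A. A \<in> sets borel}
          \<subseteq> sigma_sets (space N) {\<zeta> -` A \<inter> space N | A. A \<in> sets borel}"
      proof (rule sigma_sets_mono', rule subsetI)
        fix x assume "x \<in> {?I -` A \<inter> space N | A. A \<in> sets borel}"
        then obtain A :: "complex set" where A: "x = ?I -` A \<inter> space N" "A \<in> sets borel" by auto
        have "(\<lambda>y. indicator {ereal t<..} y :: complex) \<in> borel_measurable borel" by measurable
        from measurable_sets[OF this A(2)]
        have "(\<lambda>y. indicator {ereal t<..} y :: complex) -` A \<in> sets borel" by simp
        moreover have "x = \<zeta> -` ((\<lambda>y. indicator {ereal t<..} y :: complex) -` A) \<inter> space N"
          unfolding A(1) by (auto simp: alive_def indicator_def)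
        ultimately show "x \<in> {\<zeta> -` A \<inter> space N | A. A \<in> sets borel}" by blast
      qed
      have "{X -` A \<inter> space N | A. A \<in> sets borel} \<subseteq> sets (past u)"
        using measurable_sets[OF X(1)] by auto
      from sets.sigma_sets_subset[OF this]
      have "sigma_sets (space N) {X -` A \<inter> space N | A. A \<in> sets borel} \<subseteq> sets (past u)" by simp
      also have "\<dots> \<subseteq> sigma_sets (space N) {S t -` A \<inter> space N | t A. 0 \<le> t \<and> A \<in> sets borel}"
        unfolding sets_past by (rule sigma_sets_mono') blast
      finally show "sigma_sets (space N) {X -` A \<inter> space N | A. A \<in> sets borel}
          \<subseteq> sigma_sets (space N) {S t -` A \<inter> space N | t A. 0 \<le> t \<and> A \<in> sets borel}" .
    qed
  qed
  have "(\<integral>\<omega>. ?I \<omega> \<partial>N) = (\<integral>\<omega>. complex_of_real (indicator (alive t) \<omega>) \<partial>N)"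
    by (simp only: of_real_indicator)
  also have "\<dots> = of_real (exp (- \<kappa> * t))"
    unfolding integral_complex_of_real prob_alive[OF t, symmetric] by simp
  finally show ?thesis
    using indep_var_lebesgue_integral[OF indep int_I X(2)] by (simp only:)
qed

section \<open>The filtration of the killed process\<close>

abbreviation killed_past :: "real \<Rightarrow> 'a measure" where
  "killed_past \<equiv> nat_filtration N \<sigma>"

lemma space_killed_past [simp]: "space (killed_past u) = space N"
  by (auto simp: nat_filtration_def intro!: space_measure_of)

lemma sets_killed_past:
  "sets (killed_past u) = sigma_sets (space N) {\<sigma> s -` A \<inter> space N | s A. 0 \<le> s \<and> s \<le> u \<and> A \<in> sets borel}"
  by (auto simp: nat_filtration_def intro!: sets_measure_of)

lemma \<sigma>_killed_past_measurable: "0 \<le> s \<Longrightarrow> s \<le> u \<Longrightarrow> \<sigma> s \<in> borel_measurable (killed_past u)"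
  by (rule measurableI) (auto simp: sets_killed_past)

lemma \<sigma>_measurable:
  assumes "0 \<le> t"
  shows "\<sigma> t \<in> borel_measurable N"
proof -
  have [measurable]: "S t \<in> borel_measurable N" "\<zeta> \<in> borel_measurable N"
    using assms by (auto intro: S_measurable \<zeta>_measurable)
  have "(\<lambda>\<omega>. if ereal t < \<zeta> \<omega> then ereal (S t \<omega>) else \<infinity>) \<in> borel_measurable N"
    by measurable
  then show ?thesis
    by (rule measurable_cong[THEN iffD1, rotated]) (simp add: \<sigma>_eq assms)
qed

lemma subalgebra_killed_past: "subalgebra N (killed_past u)"
  unfolding subalgebra_def
proof
  show "sets (killed_past u) \<subseteq> events"
    unfolding sets_killed_past
    by (rule sets.sigma_sets_subset) (auto intro: measurable_sets[OF \<sigma>_measurable])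
qed simp

text \<open>On survival up to s, \<sigma> and S coincide at all times up to s, and the sets with
  such a representative form a sigma-algebra. Test events for \<sigma> can therefore be exchanged
  for events of the past of S.\<close>

lemma killed_past_trace:
  assumes "A \<in> sets (killed_past s)"
  shows "\<exists>B\<in>sets (past s). A \<inter> alive s = B \<inter> alive s"
  using assms unfolding sets_killed_past
proof (induction rule: sigma_sets.induct)
  case (Basic a)
  then obtain r A where a: "a = \<sigma> r -` A \<inter> space N" "0 \<le> r" "r \<le> s" "A \<in> sets borel" by auto
  have "S r -` (ereal -` A) \<inter> space (past s) \<in> sets (past s)"
    using measurable_sets[OF borel_measurable_ereal[OF measurable_ident_sets[OF refl]] a(4)]
    by (intro measurable_sets[OF S_past_measurable[OF a(2,3)]]) simp
  moreover have "a \<inter> alive s = (S r -` (ereal -` A) \<inter> space (past s)) \<inter> alive s"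
    unfolding a(1) using \<sigma>_alive[OF _ a(2,3)] by auto
  ultimately show ?case by blast
next
  case Empty
  then show ?case by (intro bexI[of _ "{}"]) auto
next
  case (Compl a)
  then obtain B where B: "B \<in> sets (past s)" "a \<inter> alive s = B \<inter> alive s" by auto
  have "space (past s) - B \<in> sets (past s)" using B(1) by (rule sets.compl_sets)
  moreover have "(space N - a) \<inter> alive s = (space (past s) - B) \<inter> alive s"
    using B(2) by auto
  ultimately show ?case by blast
next
  case (Union a)
  then obtain B where B: "\<And>i::nat. B i \<in> sets (past s)" "\<And>i. a i \<inter> alive s = B i \<inter> alive s" by metis
  have "(\<Union>i. B i) \<in> sets (past s)" using B(1) by auto
  moreover have "(\<Union>i. a i) \<inter> alive s = (\<Union>i. B i) \<inter> alive s"
    using B(2) by auto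
  ultimately show ?case by blast
qed

text \<open>\<open>real_of_ereal\<close> sends infinity to 0, so after killing the first two factors
  are harmless finite values and the last factor makes the product 0.\<close>

definition exp_mart :: "(real \<Rightarrow> real) \<Rightarrow> real \<Rightarrow> 'a \<Rightarrow> real" where
  "exp_mart p t \<omega> = exp (\<integral>s\<in>{0..t}. real_of_ereal (\<sigma> s \<omega>) \<partial>lborel)
     * p (- real_of_ereal (\<sigma> t \<omega>)) * (if \<sigma> t \<omega> < \<infinity> then 1 else 0)"

lemma exp_mart_eq:
  assumes "0 \<le> t" "\<omega> \<in> space N"
  shows "exp_mart p t \<omega> = indicator (alive t) \<omega> * (exp (\<integral>s\<in>{0..t}. S s \<omega> \<partial>lborel) * p (- S t \<omega>))"
proof (cases "\<omega> \<in> alive t")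
  case True
  have "(\<integral>s\<in>{0..t}. real_of_ereal (\<sigma> s \<omega>) \<partial>lborel) = (\<integral>s\<in>{0..t}. S s \<omega> \<partial>lborel)"
    by (rule set_lebesgue_integral_cong) (auto simp: \<sigma>_alive[OF True])
  then show ?thesis using True \<sigma>_alive[OF True assms(1)] by (simp add: exp_mart_def)
next
  case False
  then show ?thesis using \<sigma>_not_alive[OF assms(2,1)] by (simp add: exp_mart_def)
qed

text \<open>The time integral is replaced by Riemann sums of \<sigma> itself, which use the
  filtration of \<sigma> only. They converge to the integral while the process is alive; afterwards
  the last factor makes both sides 0.\<close>

lemma exp_mart_killed_past_measurable:
  assumes t: "0 \<le> t" and p [measurable]: "p \<in> borel_measurable borel"
  shows "exp_mart p t \<in> borel_measurable (killed_past t)"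
proof (rule borel_measurable_LIMSEQ_real)
  \<comment> \<open>The forms t - 0 and 0 + ... are kept so that the sums match
    \<open>integral_S_riemann\<close> with s = 0.\<close>
  let ?u = "\<lambda>n \<omega>. exp (\<Sum>k<Suc n. (t - 0) / real (Suc n) * real_of_ereal (\<sigma> (0 + real k * ((t - 0) / real (Suc n))) \<omega>))
     * p (- real_of_ereal (\<sigma> t \<omega>)) * (if \<sigma> t \<omega> < \<infinity> then 1 else 0)"
  have grid: "0 \<le> 0 + real k * ((t - 0) / real (Suc n))" "0 + real k * ((t - 0) / real (Suc n)) \<le> t" if "k < Suc n" for k n
    using grid_in_Icc[OF t, of k n] that by auto
  show "?u n \<in> borel_measurable (killed_past t)" for n
  proof -
    have [measurable]: "(\<lambda>\<omega>. \<Sum>k<Suc n. (t - 0) / real (Suc n) * real_of_ereal (\<sigma> (0 + real k * ((t - 0) / real (Suc n))) \<omega>))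
        \<in> borel_measurable (killed_past t)"
      by (intro borel_measurable_sum borel_measurable_times borel_measurable_const
          borel_measurable_real_of_ereal \<sigma>_killed_past_measurable grid) auto
    have [measurable]: "\<sigma> t \<in> borel_measurable (killed_past t)"
      using t by (intro \<sigma>_killed_past_measurable) auto
    show ?thesis by measurable
  qed
  fix \<omega> assume "\<omega> \<in> space (killed_past t)"
  then have \<omega>: "\<omega> \<in> space N" by simp
  show "(\<lambda>n. ?u n \<omega>) \<longlonglongrightarrow> exp_mart p t \<omega>"
  proof (cases "\<omega> \<in> alive t")
    case True
    have "(\<Sum>k<Suc n. (t - 0) / real (Suc n) * real_of_ereal (\<sigma> (0 + real k * ((t - 0) / real (Suc n))) \<omega>))
        = (\<Sum>k<Suc n. (t - 0) / real (Suc n) * S (0 + real k * ((t - 0) / real (Suc n))) \<omega>)" for n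
      using \<sigma>_alive[OF True grid] by (intro sum.cong) auto
    then have "?u n \<omega> = exp (\<Sum>k<Suc n. (t - 0) / real (Suc n) * S (0 + real k * ((t - 0) / real (Suc n))) \<omega>) * p (- S t \<omega>)" for n
      using \<sigma>_alive[OF True t] by simp
    moreover have "(\<lambda>n. exp (\<Sum>k<Suc n. (t - 0) / real (Suc n) * S (0 + real k * ((t - 0) / real (Suc n))) \<omega>) * p (- S t \<omega>))
        \<longlonglongrightarrow> exp (\<integral>s\<in>{0..t}. S s \<omega> \<partial>lborel) * p (- S t \<omega>)"
      by (intro tendsto_intros integral_S_riemann t \<omega>) auto
    ultimately show ?thesis using True by (simp only: exp_mart_eq[OF t \<omega>] indicator_simps mult_1)
  next
    case False
    then show ?thesis using \<sigma>_not_alive[OF \<omega> t False] by (simp add: exp_mart_eq[OF t \<omega>])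
  qed
qed

end

locale killed_exp_subordinator = killed_levy_subordinator + exp_subordinator
begin

text \<open>Conditional expectations are checked on events of the filtration of \<sigma>. Each is
  exchanged for an event of the past of S, after which survival factors out as exp (- \<kappa> t)
  and meets the surplus exp (\<kappa> (t - s)) of the unkilled identity. The bound on q reduces
  integrability to that of exp of the integral of S.\<close>

lemma exp_mart_martingale:
  fixes H :: "complex \<Rightarrow> complex" and q :: "real \<Rightarrow> complex"
  defines "H \<equiv> \<lambda>z. exp (G z - of_real \<kappa> * z)"
    and "q \<equiv> \<lambda>x. (\<integral>l. iexp (- (l * x)) * H (\<i> * of_real l) \<partial>lborel) / (2 * pi)"
  assumes H_int: "integrable lborel (\<lambda>l. norm (H (\<i> * of_real l)))"
    and H_lim: "((\<lambda>l. norm (H (\<i> * of_real l))) \<longlongrightarrow> 0) at_infinity"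
    and H_bound: "\<And>t. \<exists>C. \<forall>u l. 0 \<le> u \<longrightarrow> u \<le> t \<longrightarrow> norm (H (of_real u + \<i> * of_real l)) \<le> C * norm (H (\<i> * of_real l))"
    and q_cont: "continuous_on UNIV q" and q_bound: "\<And>x. norm (q x) \<le> K"
  shows "martingale N killed_past (exp_mart (\<lambda>x. Re (q x)))"
proof -
  let ?M = "exp_mart (\<lambda>x. Re (q x))"
  have [measurable]: "q \<in> borel_measurable borel" using q_cont by (rule borel_measurable_continuous_onI)
  define Y where "Y t \<omega> = of_real (exp (\<integral>x\<in>{0..t}. S x \<omega> \<partial>lborel)) * q (- S t \<omega>)" for t \<omega>
  have Y_past: "Y t \<in> borel_measurable (past t)" if "0 \<le> t" for t
  proof -
    have [measurable]: "S t \<in> borel_measurable (past t)" "(\<lambda>\<omega>. \<integral>x\<in>{0..t}. S x \<omega> \<partial>lborel) \<in> borel_measurable (past t)"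
      using that by (auto intro: S_past_measurable integral_S_past_measurable)
    show ?thesis unfolding Y_def by measurable
  qed
  have Y_int: "integrable N (Y t)" if "0 \<le> t" for t
  proof (rule Bochner_Integration.integrable_bound)
    show "integrable N (\<lambda>\<omega>. exp ((\<integral>x\<in>{0..t}. S x \<omega> \<partial>lborel) + 0 * S t \<omega>) * K)"
      using that by (intro integrable_mult_left exp_integral_S_integrable) auto
    show "Y t \<in> borel_measurable N" by (rule past_measurable_N[OF Y_past[OF that]])
    show "AE \<omega> in N. norm (Y t \<omega>) \<le> norm (exp ((\<integral>x\<in>{0..t}. S x \<omega> \<partial>lborel) + 0 * S t \<omega>) * K)"
      using order_trans[OF q_bound abs_ge_self] by (intro AE_I2) (simp add: Y_def norm_mult abs_mult)
  qed
  have M_eq: "?M t \<omega> = Re (indicator (alive t) \<omega> * Y t \<omega>)" if "0 \<le> t" "\<omega> \<in> space N" for t \<omega>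
    by (simp add: exp_mart_eq[OF that] Y_def indicator_def)
  have alive_Y_int: "integrable N (\<lambda>\<omega>. indicator (alive t) \<omega> * Y t \<omega>)" if "0 \<le> t" for t
    using integrable_mult_indicator[OF alive_sets Y_int[OF that], of t]
    by (simp add: scaleR_conv_of_real of_real_indicator)
  have M_int: "integrable N (?M t)" if "0 \<le> t" for t
    using integrable_Re[OF alive_Y_int[OF that]] M_eq[OF that]
    by (simp cong: Bochner_Integration.integrable_cong)
  have M_meas: "?M t \<in> borel_measurable (killed_past t)" if "0 \<le> t" for t
    using that by (rule exp_mart_killed_past_measurable) measurable
  have set_int: "(\<integral>\<omega>\<in>A. ?M r \<omega> \<partial>N) = Re (of_real (exp (- \<kappa> * r)) * (\<integral>\<omega>. indicator B \<omega> * Y r \<omega> \<partial>N))"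
    if r: "0 \<le> s" "s \<le> r" and A: "A \<in> sets (killed_past s)" and B: "B \<in> sets (past s)" "A \<inter> alive s = B \<inter> alive s"
    for s r A B
  proof -
    have r0: "0 \<le> r" using r by simp
    \<comment> \<open>Survival up to r implies survival up to s, which is where A and B agree; hence
      A may be replaced by B under the indicator of \<open>alive r\<close>.\<close>
    have sub: "alive r \<subseteq> alive s" using r unfolding alive_def by (auto intro: le_less_trans[of "ereal s" "ereal r"])
    have B_r: "B \<in> sets (past r)" using past_mono[OF r(2)] B(1) by auto
    have BY_past: "(\<lambda>\<omega>. indicator B \<omega> * Y r \<omega>) \<in> borel_measurable (past r)"
      using B_r Y_past[OF r0] by (intro borel_measurable_times borel_measurable_indicator)
    have B_ev: "B \<in> events" using past_subset_events B_r by auto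
    have BY_int: "integrable N (\<lambda>\<omega>. indicator B \<omega> * Y r \<omega>)"
      using integrable_mult_indicator[OF B_ev Y_int[OF r0]]
      by (simp add: scaleR_conv_of_real of_real_indicator)
    have A_ev: "A \<in> events" using subalgebra_killed_past A by (auto simp: subalgebra_def)
    have eq: "indicator A \<omega> *\<^sub>R ?M r \<omega> = Re (indicator (alive r) \<omega> * (indicator B \<omega> * Y r \<omega>))" if "\<omega> \<in> space N" for \<omega>
      using B(2) sub by (auto simp: M_eq[OF r0 that] indicator_def)
    have "(\<integral>\<omega>\<in>A. ?M r \<omega> \<partial>N) = (\<integral>\<omega>. Re (indicator (alive r) \<omega> * (indicator B \<omega> * Y r \<omega>)) \<partial>N)"
      unfolding set_lebesgue_integral_def by (rule Bochner_Integration.integral_cong[OF refl eq])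
    also have "\<dots> = Re (\<integral>\<omega>. indicator (alive r) \<omega> * (indicator B \<omega> * Y r \<omega>) \<partial>N)"
      using integrable_mult_indicator[OF alive_sets BY_int, of r]
      by (intro integral_Re) (simp add: scaleR_conv_of_real of_real_indicator)
    also have "\<dots> = Re (of_real (exp (- \<kappa> * r)) * (\<integral>\<omega>. indicator B \<omega> * Y r \<omega> \<partial>N))"
      unfolding integral_alive_times_past[OF r0 BY_past BY_int] ..
    finally show ?thesis .
  qed
  show ?thesis
    unfolding martingale_def
  proof (intro conjI allI impI; (elim conjE)?)
    fix s t :: real assume st: "0 \<le> s" "s \<le> t"
    then have t: "0 \<le> t" by simp
    interpret F: finite_measure_subalgebra N "killed_past s"
      by unfold_locales (rule subalgebra_killed_past)
    show "AE \<omega> in N. real_cond_exp N (killed_past s) (?M t) \<omega> = ?M s \<omega>"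
    proof (rule F.real_cond_exp_charact)
      fix A assume A: "A \<in> sets (killed_past s)"
      obtain B where B: "B \<in> sets (past s)" "A \<inter> alive s = B \<inter> alive s"
        using killed_past_trace[OF A] by auto
      obtain C where C: "\<And>u l. 0 \<le> u \<Longrightarrow> u \<le> t \<Longrightarrow> norm (H (of_real u + \<i> * of_real l)) \<le> C * norm (H (\<i> * of_real l))"
        using H_bound[of t] by auto
      have "(\<integral>\<omega>. indicator B \<omega> * Y t \<omega> \<partial>N) = of_real (exp (\<kappa> * (t - s))) * (\<integral>\<omega>. indicator B \<omega> * Y s \<omega> \<partial>N)"
        using fourier_exp_integral_martingale[OF st B(1), where a=\<kappa> and C=C, OF H_int[unfolded H_def] H_lim[unfolded H_def] C[unfolded H_def]]
        unfolding Y_def q_def H_def by (simp only: mult.assoc)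
      \<comment> \<open>Here - \<kappa> t + \<kappa> (t - s) = - \<kappa> s: survival up to t and
        the surplus combine to survival up to s.\<close>
      then have "of_real (exp (- \<kappa> * t)) * (\<integral>\<omega>. indicator B \<omega> * Y t \<omega> \<partial>N)
          = of_real (exp (- \<kappa> * s)) * (\<integral>\<omega>. indicator B \<omega> * Y s \<omega> \<partial>N)"
        by (simp add: mult.assoc[symmetric] mult_exp_exp algebra_simps flip: of_real_mult)
      then show "(\<integral>\<omega>\<in>A. ?M t \<omega> \<partial>N) = (\<integral>\<omega>\<in>A. ?M s \<omega> \<partial>N)"
        unfolding set_int[OF st A B] set_int[OF st(1) order_refl A B] by (rule arg_cong)
    qed (use M_int M_meas st t in auto)
  qed (use M_int M_meas in auto)
qed

end

section \<open>An integrable majorant, and the proof of the statement\<close>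

lemma exp_minus_abs_le: "exp (- \<bar>x\<bar>) \<le> 2 * inverse (1 + x\<^sup>2)" for x :: real
proof -
  have "1 + \<bar>x\<bar> + \<bar>x\<bar>\<^sup>2 / 2 \<le> exp \<bar>x\<bar>" by (rule exp_lower_Taylor_quadratic) simp
  then have "(1 + x\<^sup>2) / 2 \<le> exp \<bar>x\<bar>" by simp
  moreover have "0 < 1 + x\<^sup>2" by (simp add: add_pos_nonneg)
  ultimately show ?thesis by (simp add: exp_minus field_simps)
qed

lemma integrable_exp_minus_abs: "integrable lborel (\<lambda>x::real. exp (- \<bar>x\<bar>))"
proof (rule Bochner_Integration.integrable_bound)
  show "integrable lborel (\<lambda>x::real. 2 * inverse (1 + x\<^sup>2))"
    using integrable_inverse_1_plus_square by (simp add: set_integrable_def)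
  show "AE x in lborel. norm (exp (- \<bar>x\<bar>)) \<le> norm (2 * inverse (1 + x\<^sup>2 :: real))"
    using exp_minus_abs_le order_trans[OF _ abs_ge_self] by (intro AE_I2) auto
qed measurable

text \<open>The density is asked to be continuous because the process evaluates it at individual
  points, and \<sigma> may have atoms; for \<nu> = 0 it is deterministic until killing. Continuity
  fixes the version among almost everywhere equal densities.\<close>

theorem theorem2p1:
  fixes a b :: real
    and \<nu> :: "real measure"
    and M :: "'w measure" and L :: "real \<Rightarrow> 'w \<Rightarrow> real"
    and N :: "'v measure" and \<sigma> :: "real \<Rightarrow> 'v \<Rightarrow> ereal"
    and \<Psi>L \<Psi>\<sigma> :: "real \<Rightarrow> complex"
  assumes ab: "0 \<le> a" "0 \<le> b"
    and nu_sets: "sets \<nu> = sets borel"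
    and nu_pos: "emeasure \<nu> {..0} = 0"
    and nu_int: "(\<integral>\<^sup>+ x. ennreal (min x (x\<^sup>2)) \<partial>\<nu>) < \<infinity>"
    and PsiL: "\<And>l. \<Psi>L l = \<i> * of_real (a * l) + of_real (b\<^sup>2 * l\<^sup>2 / 2)
                 - (\<integral>x. iexp (l * x) - 1 - \<i> * of_real (l * x) \<partial>\<nu>)"
    and L_levy: "levy_process M L"
    and L_char: "\<And>t l. 0 \<le> t \<Longrightarrow>
                   (\<integral>\<omega>. iexp (l * L t \<omega>) \<partial>M) = exp (- (of_real t * \<Psi>L l))"
    and Psisigma: "\<And>l. \<Psi>\<sigma> l = of_real a - \<i> * of_real (b\<^sup>2 * l)
                 - (\<integral>x. (iexp (l * x) - 1) * of_real x \<partial>\<nu>)"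
    and sigma_sub: "killed_subordinator N a \<sigma>"
    and sigma_char: "\<And>t l. 0 \<le> t \<Longrightarrow>
                   (\<integral>\<omega>. (if \<sigma> t \<omega> < \<infinity> then iexp (l * real_of_ereal (\<sigma> t \<omega>)) else 0) \<partial>N)
                     = exp (- (of_real t * \<Psi>\<sigma> l))"
    and cond_i: "\<And>u. (\<integral>\<^sup>+ x. ennreal (exp (u * x) - 1 - u * x) \<partial>\<nu>) < \<infinity>"
    and cond_ii: "filterlim (\<lambda>l. Re (\<Psi>L l) / \<bar>l\<bar>) at_top at_infinity"
  shows "\<exists>p :: real \<Rightarrow> real.
           continuous_on UNIV p \<and> (\<forall>x. 0 \<le> p x) \<and>
           distributed M lborel (L 1) (\<lambda>x. ennreal (p x)) \<and>
           (let Mt = (\<lambda>t \<omega>. exp (\<integral>s\<in>{0..t}. real_of_ereal (\<sigma> s \<omega>) \<partial>lborel)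
                          * p (- real_of_ereal (\<sigma> t \<omega>))
                          * (if \<sigma> t \<omega> < \<infinity> then 1 else 0))
            in (\<forall>t\<ge>0. \<forall>\<omega>\<in>space N. 0 \<le> Mt t \<omega>) \<and>
               martingale N (nat_filtration N \<sigma>) Mt)"
proof -
  interpret exp_levy_measure \<nu>
  proof
    show "sets \<nu> = sets borel" by (rule nu_sets)
    note [measurable_cong] = nu_sets
    have "{..0::real} \<in> null_sets \<nu>" using nu_pos nu_sets by (auto intro: null_setsI)
    then show "AE x in \<nu>. 0 < x" by (rule AE_I') auto
    show "integrable \<nu> (\<lambda>x. exp (u * x) - 1 - u * x)" for u
    proof (rule integrableI_nonneg)
      show "AE x in \<nu>. 0 \<le> exp (u * x) - 1 - u * x"
      proof (rule AE_I2)
        fix x show "0 \<le> exp (u * x) - 1 - u * x" using exp_ge_add_one_self[of "u * x"] by linarith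
      qed
      show "(\<integral>\<^sup>+x. ennreal (exp (u * x) - 1 - u * x) \<partial>\<nu>) < \<infinity>" by (rule cond_i)
    qed measurable
  qed
  \<comment> \<open>The drift term - a z is left out here and enters \<open>H\<close> instead:
    \<open>g\<close> is then the exponent of the subordinator before killing, and \<open>H\<close>
    on the imaginary axis the characteristic function of L 1.\<close>
  define G where "G z = of_real (b\<^sup>2) * z\<^sup>2 / 2 + lap z" for z
  define g where "g z = of_real (b\<^sup>2) * z + lap' z" for z
  define H where "H z = exp (G z - of_real a * z)" for z
  have G_deriv: "(G has_field_derivative g z) (at z)" for z
    unfolding G_def g_def by (auto intro!: derivative_eq_intros lap_has_derivative)
  have G_hol: "G holomorphic_on UNIV"
    using G_deriv by (auto simp: holomorphic_on_def field_differentiable_def intro: has_field_derivative_at_within)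
  have "deriv G = g" using G_deriv by (auto intro: DERIV_imp_deriv)
  then have g_hol: "g holomorphic_on UNIV"
    using holomorphic_deriv[OF G_hol] by simp
  have PsiL_eq: "- \<Psi>L l = G (\<i> * of_real l) - of_real a * (\<i> * of_real l)" for l
    unfolding PsiL G_def lap_def by (simp add: power_mult_distrib algebra_simps)
  have Psisigma_eq: "- \<Psi>\<sigma> l = g (\<i> * of_real l) - of_real a" for l
    unfolding Psisigma g_def lap'_def by (simp add: algebra_simps)
  have H_PsiL: "H (\<i> * of_real l) = exp (- \<Psi>L l)" for l
    unfolding H_def PsiL_eq ..

  interpret M: prob_space M using L_levy by (simp add: levy_process_def)
  have L1 [measurable]: "L 1 \<in> borel_measurable M" using L_levy by (simp add: levy_process_def)
  interpret \<mu>: real_distribution "distr M borel (L 1)"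
    by (rule M.real_distribution_distr) (rule L1)
  have char_eq: "char (distr M borel (L 1)) l = H (\<i> * of_real l)" for l
    unfolding H_PsiL char_def using L_char[of 1 l] by (simp add: integral_distr)
  have H_le_1: "norm (H (\<i> * of_real l)) \<le> 1" for l
    using \<mu>.cmod_char_le_1[of l] by (simp add: char_eq)
  have H_norm: "norm (H (\<i> * of_real l)) = exp (- Re (\<Psi>L l))" for l
    unfolding H_PsiL by simp
  have "\<forall>\<^sub>F l in at_infinity. 1 \<le> Re (\<Psi>L l) / \<bar>l\<bar>"
    using cond_ii by (simp add: filterlim_at_top)
  then obtain R where R: "\<And>l. R \<le> \<bar>l\<bar> \<Longrightarrow> 1 \<le> Re (\<Psi>L l) / \<bar>l\<bar>"
    by (auto simp: eventually_at_infinity)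
  \<comment> \<open>Beyond R the bound Re \<Psi>L >= |l| gives exp (- |l|). For |l| < R, and for l =
    0, the factor exp |R| lifts the right side to at least 1, the trivial bound of a characteristic
    function.\<close>
  have H_decay: "norm (H (\<i> * of_real l)) \<le> exp \<bar>R\<bar> * exp (- \<bar>l\<bar>)" for l
  proof (cases "R \<le> \<bar>l\<bar> \<and> l \<noteq> 0")
    case True
    then have "\<bar>l\<bar> \<le> Re (\<Psi>L l)" using R[of l] by (simp add: le_divide_eq)
    then have "norm (H (\<i> * of_real l)) \<le> exp (- \<bar>l\<bar>)" by (simp add: H_norm)
    also have "\<dots> \<le> exp \<bar>R\<bar> * exp (- \<bar>l\<bar>)" by simp
    finally show ?thesis .
  next
    case False
    then have "1 \<le> exp \<bar>R\<bar> * exp (- \<bar>l\<bar>)" by (auto simp: mult_exp_exp)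
    then show ?thesis using H_le_1[of l] by linarith
  qed
  have H_cont: "continuous_on UNIV H"
    unfolding H_def by (intro holomorphic_on_imp_continuous_on holomorphic_intros G_hol)
  have H_int: "integrable lborel (\<lambda>l. H (\<i> * of_real l))"
  proof (rule Bochner_Integration.integrable_bound)
    show "integrable lborel (\<lambda>l::real. exp \<bar>R\<bar> * exp (- \<bar>l\<bar>))"
      by (intro integrable_mult_right integrable_exp_minus_abs)
    have "continuous_on UNIV (\<lambda>l::real. H (\<i> * of_real l))"
      by (intro continuous_on_compose2[OF H_cont] continuous_intros) auto
    then show "(\<lambda>l. H (\<i> * of_real l)) \<in> borel_measurable lborel"
      by (simp add: borel_measurable_continuous_onI)
  qed (use H_decay in auto)
  have H_lim: "((\<lambda>l. norm (H (\<i> * of_real l))) \<longlongrightarrow> 0) at_infinity"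
  proof (rule Lim_null_comparison)
    show "\<forall>\<^sub>F l in at_infinity. norm (norm (H (\<i> * of_real l))) \<le> exp \<bar>R\<bar> * exp (- \<bar>l\<bar>)"
      using H_decay by simp
    have "filterlim (\<lambda>l::real. \<bar>l\<bar>) at_top at_infinity"
      unfolding real_norm_def[symmetric] by (rule filterlim_norm_at_top)
    then have "((\<lambda>l::real. exp (- \<bar>l\<bar>)) \<longlongrightarrow> 0) at_infinity"
      by (intro filterlim_compose[OF exp_at_bot] filterlim_compose[OF filterlim_uminus_at_bot_at_top])
    then show "((\<lambda>l::real. exp \<bar>R\<bar> * exp (- \<bar>l\<bar>)) \<longlongrightarrow> 0) at_infinity"
      by (rule tendsto_mult_right_zero)
  qed
  have H_bound: "\<exists>C. \<forall>u l. 0 \<le> u \<longrightarrow> u \<le> t \<longrightarrow> norm (H (of_real u + \<i> * of_real l)) \<le> C * norm (H (\<i> * of_real l))" for t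
  proof -
    have "continuous_on {0..t} (\<lambda>u. H (of_real u))"
      by (intro continuous_on_compose2[OF H_cont] continuous_intros) auto
    then have "bounded ((\<lambda>u. H (of_real u)) ` {0..t})"
      by (intro compact_imp_bounded compact_continuous_image) auto
    then obtain C where "\<forall>u\<in>{0..t}. norm (H (of_real u)) \<le> C"
      unfolding bounded_iff by auto
    then have C: "norm (H (of_real u)) \<le> C" if "0 \<le> u" "u \<le> t" for u
      using that by auto
    have "norm (H (of_real u + \<i> * of_real l)) \<le> C * norm (H (\<i> * of_real l))" if "0 \<le> u" "u \<le> t" for u l
    proof -
      \<comment> \<open>The real parts of the linear and quadratic terms are additive in u and i l,
        as Re ((u + i l)^2) = u^2 - l^2; the inequality comes from \<open>lap\<close> alone.
        Exponentiating makes |H| submultiplicative, and C bounds |H| on the real segment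
        [0, t].\<close>
      have "Re (G (of_real u + \<i> * of_real l) - of_real a * (of_real u + \<i> * of_real l))
          \<le> Re (G (of_real u) - of_real a * of_real u) + Re (G (\<i> * of_real l) - of_real a * (\<i> * of_real l))"
        using Re_lap_le[OF that(1), of l] unfolding G_def
        by (simp add: power2_eq_square algebra_simps diff_divide_distrib)
      then have "norm (H (of_real u + \<i> * of_real l)) \<le> norm (H (of_real u)) * norm (H (\<i> * of_real l))"
        unfolding H_def norm_exp_eq_Re mult_exp_exp by simp
      also have "\<dots> \<le> C * norm (H (\<i> * of_real l))"
        using C[OF that] by (rule mult_right_mono) simp
      finally show ?thesis .
    qed
    then show ?thesis by blast
  qed

  have char_int: "integrable lborel (char (distr M borel (L 1)))"
    using H_int by (simp add: char_eq[abs_def])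
  define q where "q = (\<lambda>x. (\<integral>l. iexp (- (l * x)) * H (\<i> * of_real l) \<partial>lborel) / (2 * pi))"
  have q_eq: "\<mu>.fourier_density = q"
    unfolding \<mu>.fourier_density_def[abs_def] q_def char_eq ..
  have q_cont: "continuous_on UNIV q"
    using \<mu>.continuous_fourier_density[OF char_int] by (simp add: q_eq)
  have q_nonneg: "0 \<le> Re (q x)" for x
    using \<mu>.Re_fourier_density_nonneg[OF char_int, of x] by (simp add: q_eq)
  have q_bound: "norm (q x) \<le> (\<integral>l. norm (char (distr M borel (L 1)) l) \<partial>lborel)" for x
    using \<mu>.norm_fourier_density_le[OF char_int, of x] by (simp add: q_eq)
  have p_cont: "continuous_on UNIV (\<lambda>x. Re (q x))"
    by (intro continuous_intros q_cont)
  have "distr M lborel (L 1) = distr M borel (L 1)"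
    by (rule distr_cong) auto
  also have "\<dots> = density lborel (\<lambda>x. ennreal (Re (q x)))"
    using \<mu>.eq_density_fourier_density[OF char_int] by (simp add: q_eq)
  finally have distr_eq: "distr M lborel (L 1) = density lborel (\<lambda>x. ennreal (Re (q x)))" .
  have distributed: "distributed M lborel (L 1) (\<lambda>x. ennreal (Re (q x)))"
    unfolding distributed_def using distr_eq borel_measurable_continuous_onI[OF p_cont] by simp

  obtain S \<zeta> where S: "subordinator N S" and \<zeta>: "\<zeta> \<in> borel_measurable N"
      "\<And>t. 0 \<le> t \<Longrightarrow> measure N {\<omega>\<in>space N. ereal t < \<zeta> \<omega>} = exp (- a * t)"
      "prob_space.indep_set N
           (sigma_sets (space N) {\<zeta> -` A \<inter> space N | A. A \<in> sets borel})
           (sigma_sets (space N) {S t -` A \<inter> space N | t A. 0 \<le> t \<and> A \<in> sets borel})"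
      "\<And>\<omega> t. \<omega> \<in> space N \<Longrightarrow> 0 \<le> t \<Longrightarrow> \<sigma> t \<omega> = (if ereal t < \<zeta> \<omega> then ereal (S t \<omega>) else \<infinity>)"
    using sigma_sub unfolding killed_subordinator_def by blast
  interpret N: prob_space N using S by (simp add: subordinator_def levy_process_def)
  interpret K: killed_levy_subordinator N S a \<zeta> \<sigma>
    by unfold_locales (use S \<zeta> in auto)
  \<comment> \<open>The hypothesis concerns the killed process. By independence its transform is exp
    (- a t) times that of S, and multiplying by exp (a t) removes the constant a from the
    exponent.\<close>
  have S_char: "(\<integral>\<omega>. exp (\<i> * of_real l * of_real (S t \<omega>)) \<partial>N) = exp (of_real t * g (\<i> * of_real l))"
    if t: "0 \<le> t" for t l :: real
  proof -
    let ?X = "\<lambda>\<omega>. exp (\<i> * of_real l * of_real (S t \<omega>))"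
    have [measurable]: "S t \<in> borel_measurable (K.past t)" using t by (intro K.S_past_measurable) auto
    have X_past: "?X \<in> borel_measurable (K.past t)" by measurable
    have X_int: "integrable N ?X"
      by (rule N.integrable_const_bound[where B=1]) (auto intro: K.past_measurable_N[OF X_past])
    have "exp (of_real t * (g (\<i> * of_real l) - of_real a))
        = (\<integral>\<omega>. (if \<sigma> t \<omega> < \<infinity> then iexp (l * real_of_ereal (\<sigma> t \<omega>)) else 0) \<partial>N)"
      unfolding sigma_char[OF t] Psisigma_eq[symmetric] by simp
    also have "\<dots> = (\<integral>\<omega>. indicator (K.alive t) \<omega> * ?X \<omega> \<partial>N)"
    proof (rule Bochner_Integration.integral_cong[OF refl])
      fix \<omega> assume \<omega>: "\<omega> \<in> space N"
      show "(if \<sigma> t \<omega> < \<infinity> then iexp (l * real_of_ereal (\<sigma> t \<omega>)) else 0) = indicator (K.alive t) \<omega> * ?X \<omega>"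
        using K.\<sigma>_alive[of \<omega> t t] K.\<sigma>_not_alive[OF \<omega> t] t by (cases "\<omega> \<in> K.alive t") (auto simp: mult.assoc)
    qed
    also have "\<dots> = of_real (exp (- a * t)) * (\<integral>\<omega>. ?X \<omega> \<partial>N)"
      by (rule K.integral_alive_times_past[OF t X_past X_int])
    finally have "of_real (exp (a * t)) * exp (of_real t * (g (\<i> * of_real l) - of_real a))
        = of_real (exp (a * t)) * (of_real (exp (- a * t)) * (\<integral>\<omega>. ?X \<omega> \<partial>N))" by simp
    also have "\<dots> = (\<integral>\<omega>. ?X \<omega> \<partial>N)"
      unfolding mult.assoc[symmetric] of_real_mult[symmetric] mult_exp_exp by simp
    also have "of_real (exp (a * t)) * exp (of_real t * (g (\<i> * of_real l) - of_real a)) = exp (of_real t * g (\<i> * of_real l))"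
      unfolding exp_of_real[symmetric] mult_exp_exp by (simp add: algebra_simps)
    finally show ?thesis by simp
  qed
  interpret K: killed_exp_subordinator N S a \<zeta> \<sigma> g G
    by unfold_locales (use g_hol G_deriv S_char in auto)
  have "martingale N (nat_filtration N \<sigma>) (K.exp_mart (\<lambda>x. Re (q x)))"
    unfolding q_def H_def
    by (rule K.exp_mart_martingale)
       (use integrable_norm[OF H_int] H_lim H_bound q_cont q_bound in \<open>simp_all add: q_def H_def[abs_def]\<close>)
  then have mart: "martingale N (nat_filtration N \<sigma>)
      (\<lambda>t \<omega>. exp (\<integral>s\<in>{0..t}. real_of_ereal (\<sigma> s \<omega>) \<partial>lborel)
        * Re (q (- real_of_ereal (\<sigma> t \<omega>))) * (if \<sigma> t \<omega> < \<infinity> then 1 else 0))"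
    unfolding K.exp_mart_def[abs_def] .
  show ?thesis
    unfolding Let_def
    by (intro exI[of _ "\<lambda>x. Re (q x)"] conjI p_cont distributed mart allI impI ballI q_nonneg
        mult_nonneg_nonneg) auto
qed

end
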